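(* Let $(X,f)$ be the inverse limit of a sequence of graph covers $G_0\xleftarrow{\varphi_0}G_1\xleftarrow{\varphi_1}G_2\xleftarrow{\varphi_2}\cdots$ of the figure-8 type defined in the context (for any choice of the free lengths $l(n,n)\ge 2$, $n\ge 1$). Then the Cantor system $(X,f)$ is completely scrambled, topologically transitive, and not locally equicontinuous.
   Context: Walks. In a directed graph $G=(V,E)$, $E\subseteq V\times V$, a walk of length $l$ is a sequence $(v_0,\dots,v_l)$ of vertices with $(v_i,v_{i+1})\in E$ for $0\le i<l$; a circuit of period $l$ is a walk with $v_0=v_l$ and $v_0,\dots,v_{l-1}$ mutually distinct. $V(w)$ is the set of vertices of $w$ and $l(w)$ its length. If $w_1$ ends where $w_2$ starts, $w_1+w_2$ is their concatenation, and $kw$ is the $k$-fold concatenation of a closed walk $w$. A graph homomorphism is a map of vertices sending edges to edges; it is applied to walks vertex by vertex. Construction. $G_0=(V_0,E_0)$ has one vertex $v_{0,0}$ and one edge $e_{0,0}=(v_{0,0},v_{0,0})$. For $n\ge 1$, $G_n=(V_n,E_n)$ consists (all its vertices and edges) of a loop $e_{n,0}=(v_{n,0},v_{n,0})$ and $n$ circuits $c_{n,i}=(v_{n,i,0}=v_{n,0},v_{n,i,1},\dots,v_{n,i,l(n,i)}=v_{n,0})$, $1\le i\le n$, of periods $l(n,i)\ge 2$, with $V(c_{n,i})\cap V(c_{n,j})=\{v_{n,0}\}$ for $i\neq j$. The graph homomorphism $\varphi_n:G_{n+1}\to G_n$ ($n\ge 0$) satisfies $\varphi_n(v_{n+1,0})=v_{n,0}$,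 $\varphi_n(V(c_{n+1,n+1}))=\{v_{n,0}\}$, and for $1\le i\le n$, $\varphi_n(c_{n+1,i})=e_{n,0}+2c_{n,i}+2c_{n,i+1}+\cdots+2c_{n,n}+e_{n,0}$. Thus $l(n+1,i)=2+2\sum_{j=i}^n l(n,j)$ for $1\le i\le n$, while each $l(n,n)\ge 2$ is chosen arbitrarily. Inverse limit. $X=\{(x_0,x_1,\dots)\in\prod_{n\ge 0}V_n : x_n=\varphi_n(x_{n+1})\ \forall n\ge 0\}$ with the product topology ($V_n$ discrete), and $f:X\to X$ is the map defined by $f(x)=y$ iff $(x_n,y_n)\in E_n$ for all $n\ge 0$; this is a well-defined homeomorphism, and $X$ is homeomorphic to the Cantor set. A compatible metric $d$ on $X$ is fixed. Dynamical notions. A set $S\subseteq X$ is scrambled if for all $x\ne y$ in $S$, $\limsup_{n\to+\infty}d(f^n(x),f^n(y))>0$ and $\liminf_{n\to+\infty}d(f^n(x),f^n(y))=0$; $(X,f)$ is completely scrambled if $X$ itself is a scrambled set. $(X,f)$ is locally equicontinuous if every $x\in X$ is an equicontinuity point of the restriction of $f$ to the orbit closure $Y=\overline{\{f^i(x): i\in\mathbb Z\}}$, i.e. for every $\varepsilon>0$ there is $\delta>0$ such that $y\in Y$, $d(x,y)<\delta$ imply $d(f^k(x),f^k(y))<\varepsilon$ for all $k\ge 0$. *)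

theory Defs
  imports "HOL-Analysis.Analysis"
begin

section \<open>Walks in directed graphs\<close>

text \<open>A walk \<open>(v\<^sub>0, \<dots>, v\<^sub>l)\<close> is the list of its \<open>l + 1\<close> vertices; in particular it is nonempty.\<close>

definition walk :: "'v set \<Rightarrow> ('v \<times> 'v) set \<Rightarrow> 'v list \<Rightarrow> bool" where
  "walk V E w \<longleftrightarrow> w \<noteq> [] \<and> set w \<subseteq> V \<and> (\<forall>i. Suc i < length w \<longrightarrow> (w ! i, w ! Suc i) \<in> E)"

definition walk_length :: "'v list \<Rightarrow> nat" where
  "walk_length w = length w - 1"

definition walk_edges :: "'v list \<Rightarrow> ('v \<times> 'v) set" where
  "walk_edges w = {(w ! i, w ! Suc i) | i. Suc i < length w}"

definition circuit :: "'v set \<Rightarrow> ('v \<times> 'v) set \<Rightarrow> 'v list \<Rightarrow> bool" where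
  "circuit V E w \<longleftrightarrow> walk V E w \<and> hd w = last w \<and> distinct (butlast w)"

text \<open>Concatenation drops the repeated vertex; it is only meaningful if \<open>last w1 = hd w2\<close>.\<close>

definition walk_append :: "'v list \<Rightarrow> 'v list \<Rightarrow> 'v list" where
  "walk_append w1 w2 = w1 @ tl w2"

fun walk_repeat :: "nat \<Rightarrow> 'v list \<Rightarrow> 'v list" where
  "walk_repeat 0 w = [hd w]"
| "walk_repeat (Suc k) w = walk_append w (walk_repeat k w)"

definition graph_hom ::
  "'v set \<Rightarrow> ('v \<times> 'v) set \<Rightarrow> 'w set \<Rightarrow> ('w \<times> 'w) set \<Rightarrow> ('v \<Rightarrow> 'w) \<Rightarrow> bool" where
  "graph_hom V E V' E' h \<longleftrightarrow>
     (\<forall>u\<in>V. h u \<in> V') \<and> (\<forall>u w. (u, w) \<in> E \<longrightarrow> (h u, h w) \<in> E')"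


section \<open>The figure-8 type sequences of graph covers\<close>

text \<open>\<open>v n\<close> is the vertex \<open>v\<^bsub>n,0\<^esub>\<close>, so that \<open>[v n, v n]\<close> is the loop \<open>e\<^bsub>n,0\<^esub>\<close> as a walk, and
  \<open>c n i\<close> is the circuit \<open>c\<^bsub>n,i\<^esub>\<close> for \<open>1 \<le> i \<le> n\<close>; the period \<open>l(n,i)\<close> is
  \<open>walk_length (c n i)\<close>. The walk below is
  \<open>e\<^bsub>n,0\<^esub> + 2c\<^bsub>n,i\<^esub> + 2c\<^bsub>n,i+1\<^esub> + \<dots> + 2c\<^bsub>n,n\<^esub> + e\<^bsub>n,0\<^esub>\<close>.\<close>

definition cover_walk ::
  "(nat \<Rightarrow> 'v) \<Rightarrow> (nat \<Rightarrow> nat \<Rightarrow> 'v list) \<Rightarrow> nat \<Rightarrow> nat \<Rightarrow> 'v list" where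
  "cover_walk v c n i =
     walk_append [v n, v n]
       (foldr walk_append (map (\<lambda>j. walk_repeat 2 (c n j)) [i..<Suc n]) [v n, v n])"

text \<open>For \<open>n = 0\<close> there are no circuits, and \<open>G\<^sub>0\<close> is a single vertex with a loop. The periods
  \<open>l(n,n)\<close> are unconstrained apart from being at least 2; the others are determined by them
  through \<open>phi_circuit\<close>.\<close>

locale figure8_covers =
  fixes V :: "nat \<Rightarrow> 'v set"
    and E :: "nat \<Rightarrow> ('v \<times> 'v) set"
    and v :: "nat \<Rightarrow> 'v"
    and c :: "nat \<Rightarrow> nat \<Rightarrow> 'v list"
    and \<phi> :: "nat \<Rightarrow> 'v \<Rightarrow> 'v"
  assumes vertices: "\<And>n. V n = {v n} \<union> (\<Union>i\<in>{1..n}. set (c n i))"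
    and edges: "\<And>n. E n = {(v n, v n)} \<union> (\<Union>i\<in>{1..n}. walk_edges (c n i))"
    and circuits: "\<And>n i. \<lbrakk>1 \<le> i; i \<le> n\<rbrakk> \<Longrightarrow> circuit (V n) (E n) (c n i)"
    and circuit_start: "\<And>n i. \<lbrakk>1 \<le> i; i \<le> n\<rbrakk> \<Longrightarrow> hd (c n i) = v n"
    and circuit_period: "\<And>n i. \<lbrakk>1 \<le> i; i \<le> n\<rbrakk> \<Longrightarrow> 2 \<le> walk_length (c n i)"
    and circuits_meet:
      "\<And>n i j. \<lbrakk>1 \<le> i; i \<le> n; 1 \<le> j; j \<le> n; i \<noteq> j\<rbrakk> \<Longrightarrow> set (c n i) \<inter> set (c n j) = {v n}"
    and phi_hom: "\<And>n. graph_hom (V (Suc n)) (E (Suc n)) (V n) (E n) (\<phi> n)"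
    and phi_base: "\<And>n. \<phi> n (v (Suc n)) = v n"
    and phi_last_circuit: "\<And>n. \<phi> n ` set (c (Suc n) (Suc n)) = {v n}"
    and phi_circuit:
      "\<And>n i. \<lbrakk>1 \<le> i; i \<le> n\<rbrakk> \<Longrightarrow> map (\<phi> n) (c (Suc n) i) = cover_walk v c n i"


section \<open>The inverse limit\<close>

definition inverse_limit :: "(nat \<Rightarrow> 'v set) \<Rightarrow> (nat \<Rightarrow> 'v \<Rightarrow> 'v) \<Rightarrow> (nat \<Rightarrow> 'v) set" where
  "inverse_limit V \<phi> = {x \<in> (\<Pi>\<^sub>E n\<in>UNIV. V n). \<forall>n. x n = \<phi> n (x (Suc n))}"

definition inverse_limit_topology ::
  "(nat \<Rightarrow> 'v set) \<Rightarrow> (nat \<Rightarrow> 'v \<Rightarrow> 'v) \<Rightarrow> (nat \<Rightarrow> 'v) topology" where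
  "inverse_limit_topology V \<phi> =
     subtopology (product_topology (\<lambda>n. discrete_topology (V n)) UNIV) (inverse_limit V \<phi>)"

definition inverse_limit_map ::
  "(nat \<Rightarrow> 'v set) \<Rightarrow> (nat \<Rightarrow> ('v \<times> 'v) set) \<Rightarrow> (nat \<Rightarrow> 'v \<Rightarrow> 'v) \<Rightarrow> (nat \<Rightarrow> 'v) \<Rightarrow> (nat \<Rightarrow> 'v)" where
  "inverse_limit_map V E \<phi> x = (THE y. y \<in> inverse_limit V \<phi> \<and> (\<forall>n. (x n, y n) \<in> E n))"


section \<open>Dynamical notions\<close>

definition compatible_metric :: "'a topology \<Rightarrow> ('a \<Rightarrow> 'a \<Rightarrow> real) \<Rightarrow> bool" where
  "compatible_metric T d \<longleftrightarrow>
     Metric_space (topspace T) d \<and> Metric_space.mtopology (topspace T) d = T"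

definition scrambled_set :: "('a \<Rightarrow> 'a \<Rightarrow> real) \<Rightarrow> ('a \<Rightarrow> 'a) \<Rightarrow> 'a set \<Rightarrow> bool" where
  "scrambled_set d f S \<longleftrightarrow>
     (\<forall>x\<in>S. \<forall>y\<in>S. x \<noteq> y \<longrightarrow>
        limsup (\<lambda>n. ereal (d ((f ^^ n) x) ((f ^^ n) y))) > 0 \<and>
        liminf (\<lambda>n. ereal (d ((f ^^ n) x) ((f ^^ n) y))) = 0)"

definition completely_scrambled ::
  "'a topology \<Rightarrow> ('a \<Rightarrow> 'a \<Rightarrow> real) \<Rightarrow> ('a \<Rightarrow> 'a) \<Rightarrow> bool" where
  "completely_scrambled T d f \<longleftrightarrow> scrambled_set d f (topspace T)"

definition topologically_transitive :: "'a topology \<Rightarrow> ('a \<Rightarrow> 'a) \<Rightarrow> bool" where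
  "topologically_transitive T f \<longleftrightarrow>
     (\<forall>U W. openin T U \<and> U \<noteq> {} \<and> openin T W \<and> W \<noteq> {} \<longrightarrow>
        (\<exists>n>0. (f ^^ n) ` U \<inter> W \<noteq> {}))"

text \<open>The two-sided orbit \<open>{f\<^sup>i(x) : i \<in> \<int>}\<close>, for a bijection \<open>f\<close> of \<open>topspace T\<close>.\<close>

definition full_orbit :: "'a topology \<Rightarrow> ('a \<Rightarrow> 'a) \<Rightarrow> 'a \<Rightarrow> 'a set" where
  "full_orbit T f x =
     range (\<lambda>k. (f ^^ k) x) \<union> range (\<lambda>k. (inv_into (topspace T) f ^^ k) x)"

definition orbit_closure :: "'a topology \<Rightarrow> ('a \<Rightarrow> 'a) \<Rightarrow> 'a \<Rightarrow> 'a set" where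
  "orbit_closure T f x = T closure_of full_orbit T f x"

definition equicontinuity_point ::
  "('a \<Rightarrow> 'a \<Rightarrow> real) \<Rightarrow> ('a \<Rightarrow> 'a) \<Rightarrow> 'a set \<Rightarrow> 'a \<Rightarrow> bool" where
  "equicontinuity_point d f Y x \<longleftrightarrow>
     (\<forall>\<epsilon>>0. \<exists>\<delta>>0. \<forall>y\<in>Y. d x y < \<delta> \<longrightarrow> (\<forall>k. d ((f ^^ k) x) ((f ^^ k) y) < \<epsilon>))"

definition locally_equicontinuous ::
  "'a topology \<Rightarrow> ('a \<Rightarrow> 'a \<Rightarrow> real) \<Rightarrow> ('a \<Rightarrow> 'a) \<Rightarrow> bool" where
  "locally_equicontinuous T d f \<longleftrightarrow>
     (\<forall>x\<in>topspace T. equicontinuity_point d f (orbit_closure T f x) x)"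

end

theory Submission
  imports Defs
begin

text \<open>Why the system behaves as claimed. A vertex of \<open>G\<^sub>n\<close> other than the base vertex
  \<open>v n\<close> has exactly one successor, and all successors of \<open>v (Suc n)\<close> are sent to
  \<open>v n\<close> by \<open>\<phi> n\<close>, so the edges determine a map \<open>f\<close> on the inverse limit.
  Writing every circuit as the list \<open>circ n i\<close> of its vertices without the final one,
  \<open>\<phi> n\<close> turns \<open>circ (Suc n) i\<close> into the concatenation of \<open>v n\<close>, two
  copies of each of \<open>circ n i\<close>, \dots, \<open>circ n n\<close>, and \<open>v n\<close>
  (\<open>map_phi_circ\<close>). Everything below is read off from this substitution and from
  \<open>itin N k i\<close>, the image of \<open>circ (N + k) i\<close> in level \<open>N\<close>.

  Pairs come close together. Let \<open>a\<close> count the entries of \<open>itin N k i\<close> that are not the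
  base vertex. Both \<open>a\<close> and the length \<open>l\<close> satisfy
  \<open>u(k+1, i) = u(k+1, i+1) + 2 u(k, i)\<close>, but \<open>a\<close> vanishes for
  \<open>i > N\<close>. Dividing by \<open>2\<^sup>k\<close>, the Stolz-Cesaro argument and downward induction on
  \<open>i\<close> give \<open>a/l \<longlonglongrightarrow> 0\<close> (\<open>nonbase_density\<close>). Hence every
  orbit is at the base vertex of level \<open>N\<close> with density one, and any two orbits are there at the same
  time again and again (\<open>common_base_visits\<close>).

  Pairs do not stay close together. A point other than the fixed point \<open>v\<close> lies, from some level on, in
  circuits of one index \<open>i\<close>, and the time \<open>r\<^sub>n\<close> left until the end of the circuit in
  level \<open>n\<close> tends to infinity. Seen in level \<open>N > i\<close>, the circuits of level
  \<open>n\<close> end in a run of base vertices whose length does not depend on \<open>i\<close>. Counted with the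
  end of the circuit, this run is longer than every earlier one that starts after the beginning of the circuit
  (\<open>itin_gaps\<close>). If two orbits agree in level \<open>N\<close> from time \<open>K\<close> on, then the
  first run of this length after \<open>K\<close> starts simultaneously in both, so their \<open>r\<^sub>n\<close>
  agree for all large \<open>n\<close> (\<open>follows_agree_remaining\<close>); comparing the growth of
  \<open>r\<^sub>n\<close> shows that the indices agree as well, and then the points are equal
  (\<open>follows_agree_eq\<close>).

  Recurrence. The point with \<open>n\<close>-th coordinate \<open>circ n 1 ! n\<close> always lies in the first
  copy of \<open>circ n 1\<close> inside \<open>circ (n+1) 1\<close>, so it goes through \<open>circ n 1\<close>
  completely once more. Its orbit visits every vertex of every level at arbitrarily late times, which gives
  transitivity. After \<open>len n 1\<close> steps it is back at the same vertex of level \<open>n\<close>; by the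
  previous paragraph, this nearby point of its own orbit separates from it in the fixed level \<open>2\<close>, which
  contradicts local equicontinuity.\<close>

section \<open>Concatenation of closed walks\<close>

text \<open>A walk that ends in \<open>a\<close> is written \<open>A @ [a]\<close>. For walks from \<open>a\<close>
  to \<open>a\<close> this turns the concatenation of walks, which drops a repeated vertex, into plain list
  append.\<close>

lemma walk_append_closed:
  assumes "hd (B @ [a]) = a"
  shows "walk_append (A @ [a]) (B @ [a]) = (A @ B) @ [a]"
  using assms by (cases B) (auto simp: walk_append_def)

lemma walk_repeat_2_closed:
  assumes "hd (B @ [a]) = a"
  shows "walk_repeat 2 (B @ [a]) = (B @ B) @ [a]"
proof -
  have "walk_append (B @ [a]) ([] @ [a]) = (B @ []) @ [a]"
    by (rule walk_append_closed) simp
  then show ?thesis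
    using walk_append_closed[OF assms, of B] assms by (simp add: numeral_2_eq_2)
qed

lemma hd_concat_append:
  assumes "\<forall>B\<in>set Bs. B \<noteq> [] \<and> hd B = a" and "A \<noteq> [] \<and> hd A = a"
  shows "hd (concat Bs @ A) = a"
  using assms by (cases Bs) auto

lemma foldr_walk_append_closed:
  assumes "\<forall>B\<in>set Bs. B \<noteq> [] \<and> hd B = a" and "A \<noteq> [] \<and> hd A = a"
  shows "foldr walk_append (map (\<lambda>B. B @ [a]) Bs) (A @ [a]) = (concat Bs @ A) @ [a]"
  using assms(1)
proof (induction Bs)
  case (Cons B Bs)
  have "hd ((concat Bs @ A) @ [a]) = a"
    using hd_concat_append[of Bs a "A @ [a]"] Cons.prems assms(2) by simp
  then show ?case
    using Cons walk_append_closed[of "concat Bs @ A" a B] by simp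
qed simp

section \<open>Lists with short runs of one entry\<close>

text \<open>The entries different from \<open>b\<close> are spread densely over \<open>Z\<close>: from every position,
  the next such entry, possibly the current one, is at most \<open>g\<close> away. In particular the last entry is
  different from \<open>b\<close>. The initial run of \<open>b\<close> is measured separately by \<open>a\<close>
  because in the itineraries below it is too long by one: there \<open>a = g + 1\<close> can occur.\<close>

definition gaps_le :: "'a \<Rightarrow> nat \<Rightarrow> nat \<Rightarrow> 'a list \<Rightarrow> bool" where
  "gaps_le b a g Z \<longleftrightarrow>
     (\<exists>q\<le>a. q < length Z \<and> Z ! q \<noteq> b) \<and>
     (\<forall>q. 1 \<le> q \<and> q < length Z \<longrightarrow>
       (\<exists>q'\<ge>q. (q' \<le> a \<or> q' \<le> q + g) \<and> q' < length Z \<and> Z ! q' \<noteq> b))"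

lemma gaps_le_mono: "gaps_le b a g Z \<Longrightarrow> g \<le> g' \<Longrightarrow> gaps_le b a g' Z"
  unfolding gaps_le_def by (meson add_le_cancel_left le_trans)

lemma gaps_le_Cons:
  assumes "gaps_le b a g Z" shows "gaps_le b (Suc a) g (b # Z)"
proof -
  obtain q0 where q0: "q0 \<le> a" "q0 < length Z" "Z ! q0 \<noteq> b"
    using assms by (auto simp: gaps_le_def)
  have "\<exists>q'\<ge>q. (q' \<le> Suc a \<or> q' \<le> q + g) \<and> q' < length (b # Z) \<and> (b # Z) ! q' \<noteq> b"
    if q: "1 \<le> q" "q < length (b # Z)" for q
  proof (cases "q = 1")
    case True
    then show ?thesis using q0 by (intro exI[of _ "Suc q0"]) auto
  next
    case False
    then obtain m where m: "q = Suc m" "1 \<le> m" "m < length Z"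
      using q False by (cases q) auto
    then obtain q' where "q' \<ge> m" "q' \<le> a \<or> q' \<le> m + g" "q' < length Z" "Z ! q' \<noteq> b"
      using assms by (auto simp: gaps_le_def)
    then show ?thesis using m by (intro exI[of _ "Suc q'"]) auto
  qed
  then show ?thesis
    unfolding gaps_le_def using q0 by (intro conjI exI[of _ "Suc q0"]) auto
qed

text \<open>The only new run is the one across the joint, formed by the \<open>t\<close> separating entries and the
  initial run of \<open>Y\<close>.\<close>

lemma gaps_le_join:
  assumes Z: "gaps_le b a g Z" and Y: "gaps_le b a g Y" and "t + a \<le> g"
  shows "gaps_le b a g (Z @ replicate t b @ Y)"
proof -
  let ?W = "Z @ replicate t b @ Y" and ?d = "length Z + t"
  have WY: "?W ! (?d + m) = Y ! m" for m
    by (metis append.assoc length_append length_replicate nth_append_length_plus)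
  obtain q0 where q0: "q0 \<le> a" "q0 < length Z" "Z ! q0 \<noteq> b"
    using Z by (auto simp: gaps_le_def)
  obtain y0 where y0: "y0 \<le> a" "y0 < length Y" "Y ! y0 \<noteq> b"
    using Y by (auto simp: gaps_le_def)
  have "\<exists>q'\<ge>q. (q' \<le> a \<or> q' \<le> q + g) \<and> q' < length ?W \<and> ?W ! q' \<noteq> b"
    if q: "1 \<le> q" "q < length ?W" for q
  proof -
    consider "q < length Z" | "length Z \<le> q" "q \<le> ?d" | "?d < q" by linarith
    then show ?thesis
    proof cases
      case 1
      then obtain q' where "q' \<ge> q" "q' \<le> a \<or> q' \<le> q + g" "q' < length Z" "Z ! q' \<noteq> b"
        using Z q by (auto simp: gaps_le_def)
      then show ?thesis by (intro exI[of _ q']) (auto simp: nth_append)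
    next
      case 2
      have "?d + y0 \<le> q + g" using 2 y0 assms(3) by linarith
      then show ?thesis using 2 y0 WY[of y0] by (intro exI[of _ "?d + y0"]) auto
    next
      case 3
      define m where "m = q - ?d"
      have m: "q = ?d + m" "1 \<le> m" "m < length Y" using 3 q by (auto simp: m_def)
      then obtain q' where q': "q' \<ge> m" "q' \<le> a \<or> q' \<le> m + g" "q' < length Y" "Y ! q' \<noteq> b"
        using Y by (auto simp: gaps_le_def)
      then have "?d + q' \<le> q + g" using m assms(3) by linarith
      then show ?thesis using m q' WY[of q'] by (intro exI[of _ "?d + q'"]) auto
    qed
  qed
  then show ?thesis
    unfolding gaps_le_def using q0
    by (intro conjI exI[of _ q0]) (auto simp: nth_append)
qed

lemma gaps_le_concat:
  assumes "Bs \<noteq> []" "\<forall>B\<in>set Bs. \<exists>Z. B = Z @ replicate t b \<and> gaps_le b a g Z" "t + a \<le> g"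
  shows "\<exists>Z. concat Bs = Z @ replicate t b \<and> gaps_le b a g Z"
  using assms(1,2)
proof (induction Bs rule: list_nonempty_induct)
  case (single B)
  then show ?case by simp
next
  case (cons B Bs)
  then obtain Z Y where "B = Z @ replicate t b" "gaps_le b a g Z"
    "concat Bs = Y @ replicate t b" "gaps_le b a g Y"
    by auto
  then show ?case
    using gaps_le_join[of b a g Z Y t] assms(3)
    by (intro exI[of _ "Z @ replicate t b @ Y"]) auto
qed

section \<open>Upper and lower limits\<close>

lemma limsup_pos:
  assumes "0 < \<epsilon>" "\<And>K. \<exists>s\<ge>K. \<epsilon> \<le> u s"
  shows "0 < limsup (\<lambda>s. ereal (u s))"
proof (rule ccontr)
  assume "\<not> ?thesis"
  then have "limsup (\<lambda>s. ereal (u s)) \<le> 0"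
    by simp
  also have "0 < ereal \<epsilon>"
    using assms(1) by simp
  finally have "eventually (\<lambda>s. ereal (u s) < ereal \<epsilon>) sequentially"
    by (rule Limsup_lessD)
  then obtain K where "\<forall>s\<ge>K. ereal (u s) < ereal \<epsilon>"
    unfolding eventually_sequentially by blast
  then show False
    using assms(2)[of K] by force
qed

lemma liminf_zero:
  assumes "\<And>s. 0 \<le> u s" "\<And>\<epsilon> K. 0 < \<epsilon> \<Longrightarrow> \<exists>s\<ge>K. u s < \<epsilon>"
  shows "liminf (\<lambda>s. ereal (u s)) = 0"
proof (rule antisym)
  show "0 \<le> liminf (\<lambda>s. ereal (u s))"
    by (rule Liminf_bounded) (use assms(1) in simp)
  show "liminf (\<lambda>s. ereal (u s)) \<le> 0"
  proof (rule ccontr)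
    assume "\<not> ?thesis"
    then have "0 < liminf (\<lambda>s. ereal (u s))" by simp
    from ereal_dense2[OF this]
    obtain \<epsilon> where e: "0 < ereal \<epsilon>" "ereal \<epsilon> < liminf (\<lambda>s. ereal (u s))" by blast
    then obtain K where "\<forall>s\<ge>K. ereal \<epsilon> < ereal (u s)"
      using less_LiminfD[OF e(2)] unfolding eventually_sequentially by blast
    then show False
      using assms(2)[of \<epsilon> K] e(1) by force
  qed
qed

context figure8_covers
begin

section \<open>Circuits without their final vertex\<close>

definition circ :: "nat \<Rightarrow> nat \<Rightarrow> 'v list" where
  "circ n i = butlast (c n i)"

definition len :: "nat \<Rightarrow> nat \<Rightarrow> nat" where
  "len n i = length (circ n i)"

lemma length_circ [simp]: "length (circ n i) = len n i"
  by (simp add: len_def)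

lemma len_ge_2: "\<lbrakk>1 \<le> i; i \<le> n\<rbrakk> \<Longrightarrow> 2 \<le> len n i"
  using circuit_period[of i n] by (simp add: walk_length_def circ_def flip: length_circ)

lemma c_eq_circ:
  assumes "1 \<le> i" "i \<le> n" shows "c n i = circ n i @ [v n]"
proof -
  have "c n i \<noteq> []" "last (c n i) = v n"
    using circuits[OF assms] circuit_start[OF assms] by (auto simp: circuit_def walk_def)
  then show ?thesis
    unfolding circ_def by (metis append_butlast_last_id)
qed

lemma distinct_circ: "\<lbrakk>1 \<le> i; i \<le> n\<rbrakk> \<Longrightarrow> distinct (circ n i)"
  using circuits[of i n] by (simp add: circuit_def circ_def)

lemma circ_nonempty: "\<lbrakk>1 \<le> i; i \<le> n\<rbrakk> \<Longrightarrow> circ n i \<noteq> []"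
  using len_ge_2[of i n] length_circ[of n i] by fastforce

lemma hd_circ: "\<lbrakk>1 \<le> i; i \<le> n\<rbrakk> \<Longrightarrow> hd (circ n i) = v n"
  using circuit_start[of i n] c_eq_circ[of i n] circ_nonempty[of i n] by simp

lemma circ_0: "\<lbrakk>1 \<le> i; i \<le> n\<rbrakk> \<Longrightarrow> circ n i ! 0 = v n"
  using hd_circ circ_nonempty by (metis hd_conv_nth)

lemma circ_eq_base_iff:
  "\<lbrakk>1 \<le> i; i \<le> n; p < len n i\<rbrakk> \<Longrightarrow> circ n i ! p = v n \<longleftrightarrow> p = 0"
  using circ_0[of i n] nth_eq_iff_index_eq[OF distinct_circ, of i n p 0] by auto

lemma set_circ: "\<lbrakk>1 \<le> i; i \<le> n\<rbrakk> \<Longrightarrow> set (circ n i) = set (c n i)"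
  using c_eq_circ[of i n] circ_nonempty[of i n] hd_circ[of i n] hd_in_set[of "circ n i"] by auto

lemma base_in_V: "v n \<in> V n"
  using vertices by auto

lemma circ_in_V: "\<lbrakk>1 \<le> i; i \<le> n; p < len n i\<rbrakk> \<Longrightarrow> circ n i ! p \<in> V n"
  using vertices[of n] set_circ[of i n] nth_mem[of p "circ n i"] by auto

text \<open>Different circuits share only the base vertex, so any other vertex determines its circuit and its position
  there.\<close>

lemma circ_inj:
  assumes "1 \<le> i" "i \<le> n" "1 \<le> j" "j \<le> n" "p < len n i" "q < len n j"
    and "circ n i ! p = circ n j ! q" and "circ n i ! p \<noteq> v n"
  shows "i = j \<and> p = q"
proof -
  have "circ n i ! p \<in> set (c n i) \<inter> set (c n j)"
    using assms set_circ by (metis IntI length_circ nth_mem)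
  then have "i = j"
    using circuits_meet[of i n j] assms by blast
  then show ?thesis
    using assms distinct_circ[of i n] by (auto simp: nth_eq_iff_index_eq)
qed

lemma vertex_cases:
  assumes "u \<in> V n"
  obtains "u = v n"
  | i p where "1 \<le> i" "i \<le> n" "1 \<le> p" "p < len n i" "u = circ n i ! p"
proof (cases "u = v n")
  case False
  then obtain i where i: "1 \<le> i" "i \<le> n" "u \<in> set (c n i)"
    using assms vertices[of n] by auto
  then obtain p where p: "p < len n i" "u = circ n i ! p"
    using set_circ[of i n] by (metis in_set_conv_nth length_circ)
  then have "1 \<le> p"
    using False circ_eq_base_iff[of i n p] i by (cases p) auto
  then show ?thesis
    using that i p by blast
qed (use that in blast)

lemma finite_V: "finite (V n)"
  using vertices by simp

lemma edge_cases:
  assumes "(u, w) \<in> E n"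
  obtains "u = v n" "w = v n"
  | i p where "1 \<le> i" "i \<le> n" "p < len n i" "u = circ n i ! p"
      "w = (if Suc p = len n i then v n else circ n i ! Suc p)"
proof (cases "(u, w) = (v n, v n)")
  case False
  then obtain i p where "1 \<le> i" "i \<le> n" "Suc p < length (c n i)" "u = c n i ! p" "w = c n i ! Suc p"
    using assms edges[of n] by (auto simp: walk_edges_def)
  then show ?thesis
    using that(2)[of i p] by (auto simp: c_eq_circ nth_append split: if_splits)
qed (use that in blast)

lemma circ_edge:
  assumes "1 \<le> i" "i \<le> n" "p < len n i"
  shows "(circ n i ! p, if Suc p = len n i then v n else circ n i ! Suc p) \<in> E n"
proof -
  have "(c n i ! p, c n i ! Suc p) \<in> walk_edges (c n i)"
    using assms by (auto simp: walk_edges_def c_eq_circ)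
  moreover have "c n i ! p = circ n i ! p"
    "c n i ! Suc p = (if Suc p = len n i then v n else circ n i ! Suc p)"
    using assms by (auto simp: c_eq_circ nth_append)
  ultimately show ?thesis
    using edges[of n] assms by auto
qed

text \<open>All branching of the graphs takes place at the base vertex.\<close>

lemma circ_successor:
  assumes "1 \<le> i" "i \<le> n" "1 \<le> p" "p < len n i" "(circ n i ! p, w) \<in> E n"
  shows "w = (if Suc p = len n i then v n else circ n i ! Suc p)"
proof -
  have nb: "circ n i ! p \<noteq> v n"
    using assms circ_eq_base_iff by simp
  from assms(5) show ?thesis
  proof (cases rule: edge_cases)
    case 1
    then show ?thesis using nb by simp
  next
    case (2 j q)
    then have "i = j \<and> p = q"
      using assms nb by (intro circ_inj) auto
    then show ?thesis using 2 by simp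
  qed
qed

section \<open>The bonding maps as substitutions\<close>

lemma circ_last_image:
  assumes "p < len (Suc n) (Suc n)"
  shows "\<phi> n (circ (Suc n) (Suc n) ! p) = v n"
  using assms phi_last_circuit[of n] set_circ[of "Suc n" "Suc n"] 
  by (metis One_nat_def Suc_le_mono image_eqI le0 le_refl length_circ nth_mem singletonD)

lemma map_phi_circ:
  assumes "1 \<le> i" "i \<le> n"
  shows "map (\<phi> n) (circ (Suc n) i) =
    [v n] @ concat (map (\<lambda>j. circ n j @ circ n j) [i..<Suc n]) @ [v n]"
proof -
  define Bs where "Bs = map (\<lambda>j. circ n j @ circ n j) [i..<Suc n]"
  have hd: "circ n j \<noteq> [] \<and> hd (circ n j) = v n" if "j \<in> set [i..<Suc n]" for j
    using that assms hd_circ[of j n] circ_nonempty[of j n] by auto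
  have "map (\<lambda>j. walk_repeat 2 (c n j)) [i..<Suc n] = map (\<lambda>B. B @ [v n]) Bs"
    unfolding Bs_def map_map comp_def
  proof (rule map_cong)
    fix j assume j: "j \<in> set [i..<Suc n]"
    then show "walk_repeat 2 (c n j) = (circ n j @ circ n j) @ [v n]"
      using walk_repeat_2_closed[of "circ n j" "v n"] hd[OF j] c_eq_circ[of j n] j assms by auto
  qed simp
  moreover have hdB: "\<forall>B\<in>set Bs. B \<noteq> [] \<and> hd B = v n"
    using hd unfolding Bs_def by auto
  then have "foldr walk_append (map (\<lambda>B. B @ [v n]) Bs) ([v n] @ [v n]) = (concat Bs @ [v n]) @ [v n]"
    by (intro foldr_walk_append_closed) auto
  moreover have "hd ((concat Bs @ [v n]) @ [v n]) = v n"
    using hd_concat_append[OF hdB, of "[v n] @ [v n]"] by simp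
  note walk_append_closed[OF this, of "[v n]"]
  ultimately have "map (\<phi> n) (c (Suc n) i) = ([v n] @ concat Bs @ [v n]) @ [v n]"
    using phi_circuit[OF assms] by (simp add: cover_walk_def)
  then have "map (\<phi> n) (circ (Suc n) i) @ [v n] = ([v n] @ concat Bs @ [v n]) @ [v n]"
    using assms phi_base by (simp add: c_eq_circ)
  then show ?thesis unfolding Bs_def by blast
qed

lemma len_Suc:
  assumes "1 \<le> i" "i \<le> n"
  shows "len (Suc n) i = 2 + 2 * (\<Sum>j=i..n. len n j)"
proof -
  have "len (Suc n) i = length (map (\<phi> n) (circ (Suc n) i))" by simp
  also have "\<dots> = 2 + sum_list (map (\<lambda>j. len n j + len n j) [i..<Suc n])"
    unfolding map_phi_circ[OF assms] by (simp add: length_concat comp_def)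
  also have "\<dots> = 2 + (\<Sum>j=i..n. len n j + len n j)"
    by (simp add: interv_sum_list_conv_sum_set_nat atLeastLessThanSuc_atLeastAtMost del: upt_Suc)
  finally show ?thesis by (simp add: sum.distrib)
qed

lemma map_phi_circ_first:
  assumes "1 \<le> i" "i \<le> n"
  shows "map (\<phi> n) (circ (Suc n) i) = [v n] @ circ n i @ circ n i @
     concat (map (\<lambda>j. circ n j @ circ n j) [Suc i..<Suc n]) @ [v n]"
proof -
  have "[i..<Suc n] = i # [Suc i..<Suc n]" using assms by (simp add: upt_conv_Cons)
  then show ?thesis unfolding map_phi_circ[OF assms] by simp
qed

lemma phi_circ_copies:
  assumes "1 \<le> i" "i \<le> n" "p < len n i"
  shows "\<phi> n (circ (Suc n) i ! (1 + p)) = circ n i ! p"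
    and "\<phi> n (circ (Suc n) i ! (1 + len n i + p)) = circ n i ! p"
proof -
  have "(\<Sum>j=i..n. len n j) \<ge> len n i" using assms by (simp add: member_le_sum)
  then have l: "1 + len n i + p < len (Suc n) i" using len_Suc[OF assms(1,2)] assms(3) by simp
  have "\<phi> n (circ (Suc n) i ! (1 + p)) = map (\<phi> n) (circ (Suc n) i) ! (1+p)"
    using l by (subst nth_map) auto
  then show "\<phi> n (circ (Suc n) i ! (1 + p)) = circ n i ! p"
    using assms(3) unfolding map_phi_circ_first[OF assms(1,2)] by (simp add: nth_append)
  have "\<phi> n (circ (Suc n) i ! (1 + len n i + p)) = map (\<phi> n) (circ (Suc n) i) ! (1+ len n i + p)"
    using l by (subst nth_map) auto
  then show "\<phi> n (circ (Suc n) i ! (1 + len n i + p)) = circ n i ! p"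
    using assms(3) unfolding map_phi_circ_first[OF assms(1,2)] by (simp add: nth_append)
qed

text \<open>A vertex of \<open>circ n i\<close> other than \<open>v n\<close> occurs in the image of
  \<open>circ (Suc n) i\<close> only within the two copies of \<open>circ n i\<close>, since the copies of the
  other circuits meet \<open>circ n i\<close> only in \<open>v n\<close>.\<close>

lemma phi_circ_preimage_cases:
  assumes "1 \<le> i" "i \<le> n" "q < len (Suc n) i" "1 \<le> p" "p < len n i"
    and "\<phi> n (circ (Suc n) i ! q) = circ n i ! p"
  shows "q = 1 + p \<or> q = 1 + len n i + p"
proof -
  let ?R = "concat (map (\<lambda>j. circ n j @ circ n j) [Suc i..<Suc n])"
  let ?w = "[v n] @ circ n i @ circ n i @ ?R @ [v n]"
  have nb: "circ n i ! p \<noteq> v n" using assms circ_eq_base_iff by simp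
  have R: "circ n i ! p \<notin> set ?R"
  proof
    assume "circ n i ! p \<in> set ?R"
    then obtain j where "j \<in> set [Suc i..<Suc n]" and in_j: "circ n i ! p \<in> set (circ n j)"
      by (auto simp del: upt_Suc set_upt)
    then have j: "i < j" "j \<le> n"
      by auto
    obtain q where "q < len n j" "circ n i ! p = circ n j ! q"
      using in_j by (metis in_set_conv_nth length_circ)
    then show False using circ_inj[of i n j p q] j in_j assms nb by auto
  qed
  have eq: "?w ! q = circ n i ! p"
    using assms(3,6) unfolding map_phi_circ_first[OF assms(1,2), symmetric] by simp
  have lw: "q < length ?w"
    using assms(3) unfolding map_phi_circ_first[OF assms(1,2), symmetric] by simp
  have idx: "a = p" if "circ n i ! a = circ n i ! p" "a < len n i" for a
    using that assms distinct_circ[of i n] by (simp add: nth_eq_iff_index_eq)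
  consider "q = 0" | "1 \<le> q" "q < 1 + len n i" | "1 + len n i \<le> q" "q < 1 + 2 * len n i"
    | "1 + 2 * len n i \<le> q" by linarith
  then show ?thesis
  proof cases
    case 1 then show ?thesis using eq nb by simp
  next
    case 2
    then obtain a where a: "q = Suc a" "a < len n i"
      by (cases q) auto
    then have "circ n i ! a = circ n i ! p"
      using eq by (simp add: nth_append)
    then show ?thesis
      using idx a by simp
  next
    case 3
    then obtain a where "q = 1 + len n i + a"
      using le_Suc_ex by blast
    then have a: "q = Suc (len n i + a)" "a < len n i"
      using 3 by auto
    then have "circ n i ! a = circ n i ! p"
      using eq by (simp add: nth_append)
    then show ?thesis
      using idx a by simp
  next
    case 4
    define a where "a = q - (1 + 2 * len n i)"
    have q: "q = length ([v n] @ circ n i @ circ n i) + a" using 4 by (simp add: a_def)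
    have "?w = ([v n] @ circ n i @ circ n i) @ (?R @ [v n])"
      by (simp only: append.assoc)
    then have "(?R @ [v n]) ! a = ?w ! q"
      unfolding q by (simp only: nth_append_length_plus)
    moreover have "a < length (?R @ [v n])" using lw q by simp
    ultimately have "circ n i ! p \<in> set (?R @ [v n])" using eq by (metis nth_mem)
    then have "circ n i ! p \<in> set [v n]"
      using R by (metis Un_iff set_append)
    then show ?thesis using nb by simp
  qed
qed

lemma phi_circ_index_mono:
  assumes "1 \<le> i" "i \<le> Suc n" "q < len (Suc n) i" "1 \<le> j" "j \<le> n" "p < len n j"
    and "\<phi> n (circ (Suc n) i ! q) = circ n j ! p" and "circ n j ! p \<noteq> v n"
  shows "i \<le> j"
proof (cases "i = Suc n")
  case True
  then show ?thesis using assms circ_last_image by simp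
next
  case False
  then have i: "i \<le> n" using assms by simp
  have "circ n j ! p \<in> set (map (\<phi> n) (circ (Suc n) i))"
    using assms(3,7) by (metis length_circ length_map nth_map nth_mem)
  then have "circ n j ! p \<in> set (concat (map (\<lambda>j. circ n j @ circ n j) [i..<Suc n]))"
    unfolding map_phi_circ[OF assms(1) i] using assms(8) by auto
  then obtain k where k: "i \<le> k" "k \<le> n" "circ n j ! p \<in> set (circ n k)" by auto
  then obtain q where "q < len n k" "circ n j ! p = circ n k ! q"
    by (metis in_set_conv_nth length_circ)
  then show ?thesis using circ_inj[of j n k p q] k assms by auto
qed

section \<open>The map on the inverse limit\<close>

abbreviation X :: "(nat \<Rightarrow> 'v) set" where
  "X \<equiv> inverse_limit V \<phi>"

abbreviation f :: "(nat \<Rightarrow> 'v) \<Rightarrow> (nat \<Rightarrow> 'v)" where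
  "f \<equiv> inverse_limit_map V E \<phi>"

lemma X_iff: "x \<in> X \<longleftrightarrow> (\<forall>n. x n \<in> V n) \<and> (\<forall>n. x n = \<phi> n (x (Suc n)))"
  by (simp only: inverse_limit_def mem_Collect_eq PiE_UNIV_domain Pi_iff ball_UNIV)

lemma X_in_V: "x \<in> X \<Longrightarrow> x n \<in> V n"
  by (metis X_iff)

lemma X_phi: "x \<in> X \<Longrightarrow> \<phi> n (x (Suc n)) = x n"
  by (metis X_iff)

lemma phi_V: "u \<in> V (Suc n) \<Longrightarrow> \<phi> n u \<in> V n"
  using phi_hom[of n] by (auto simp: graph_hom_def)

lemma phi_E: "(u, w) \<in> E (Suc n) \<Longrightarrow> (\<phi> n u, \<phi> n w) \<in> E n"
  using phi_hom[of n] by (auto simp: graph_hom_def)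

lemma base_loop: "(v n, v n) \<in> E n"
  using edges by auto

lemma successor_exists:
  assumes "u \<in> V n" shows "\<exists>w\<in>V n. (u, w) \<in> E n"
  using assms
proof (cases rule: vertex_cases)
  case 1
  then show ?thesis using base_loop base_in_V by blast
next
  case (2 i p)
  then show ?thesis
    using circ_edge[of i n p] base_in_V circ_in_V[of i n "Suc p"] by (cases "Suc p = len n i") auto
qed

lemma phi_successor_of_base:
  assumes "(v (Suc n), w) \<in> E (Suc n)" shows "\<phi> n w = v n"
  using assms
proof (cases rule: edge_cases)
  case 1
  then show ?thesis by (simp add: phi_base)
next
  case (2 i p)
  then have p: "p = 0" and l: "2 \<le> len (Suc n) i"
    using circ_eq_base_iff[of i "Suc n" p] len_ge_2[of i "Suc n"] by auto
  then have w: "w = circ (Suc n) i ! 1" using 2 by auto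
  show ?thesis
  proof (cases "i = Suc n")
    case True
    then show ?thesis using circ_last_image l w by simp
  next
    case False
    then have "\<phi> n w = circ n i ! 0"
      using phi_circ_copies(1)[of i n 0] w 2 len_ge_2[of i n] by simp
    then show ?thesis using circ_0 False 2 by simp
  qed
qed

text \<open>The bonding maps undo the branching: a walk can leave the base vertex of level \<open>Suc n\<close> along
  any circuit, but every image of a circuit starts with the loop at \<open>v n\<close>. This makes \<open>f\<close>
  well defined.\<close>

lemma phi_successor_unique:
  assumes "(u, w) \<in> E (Suc n)" "(u, w') \<in> E (Suc n)" "u \<in> V (Suc n)"
  shows "\<phi> n w = \<phi> n w'"
  using assms(3)
proof (cases rule: vertex_cases)
  case 1
  then show ?thesis using assms phi_successor_of_base by simp
next
  case (2 i p)
  then show ?thesis using circ_successor[OF 2(1-4)] assms(1,2) by metis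
qed

lemma f_unique_exists:
  assumes x: "x \<in> X"
  shows "\<exists>!y. y \<in> X \<and> (\<forall>n. (x n, y n) \<in> E n)"
proof -
  have "\<forall>n. \<exists>w. w \<in> V n \<and> (x n, w) \<in> E n"
    using successor_exists X_in_V[OF x] by blast
  then obtain s where s: "\<And>n. s n \<in> V n" "\<And>n. (x n, s n) \<in> E n"
    by metis
  \<comment> \<open>The successor in level \<open>n\<close> is ambiguous at the base vertex, its image from one level higher is not.\<close>
  define y where "y = (\<lambda>n. \<phi> n (s (Suc n)))"
  have edge: "(x n, y n) \<in> E n" for n
    using phi_E[OF s(2)[of "Suc n"]] X_phi[OF x] by (simp add: y_def)
  have phi_s: "\<phi> n w = y n" if "(x (Suc n), w) \<in> E (Suc n)" for n w
    unfolding y_def using phi_successor_unique[OF that s(2)] X_in_V[OF x] by simp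
  have "y \<in> X"
    unfolding X_iff using phi_s[OF edge] s(1) phi_V y_def by metis
  moreover have "z = y" if "z \<in> X" "\<forall>n. (x n, z n) \<in> E n" for z
    using phi_s that X_phi[OF that(1)] by (metis ext)
  ultimately show ?thesis using edge by blast
qed

lemma f_in_X: "x \<in> X \<Longrightarrow> f x \<in> X"
  and f_edge: "x \<in> X \<Longrightarrow> (x n, f x n) \<in> E n"
  using theI'[OF f_unique_exists] unfolding inverse_limit_map_def by blast+

lemma funpow_in_X: "x \<in> X \<Longrightarrow> (f ^^ k) x \<in> X"
  by (induction k) (auto simp: f_in_X)

lemma funpow_edge: "x \<in> X \<Longrightarrow> ((f ^^ k) x n, (f ^^ Suc k) x n) \<in> E n"
  using f_edge[OF funpow_in_X] by simp

lemma nth_c: "\<lbrakk>1 \<le> i; i \<le> n; p \<le> len n i\<rbrakk> \<Longrightarrow>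
    c n i ! p = (if p = len n i then v n else circ n i ! p)"
  by (auto simp: c_eq_circ nth_append)

text \<open>Position \<open>0\<close> has to be excluded: from there the orbit may leave along another
  circuit.\<close>

lemma funpow_along_circ:
  assumes "x \<in> X" "1 \<le> i" "i \<le> n" "1 \<le> p" "x n = c n i ! p" "p + k \<le> len n i"
  shows "(f ^^ k) x n = c n i ! (p + k)"
  using assms(6)
proof (induction k)
  case 0
  then show ?case using assms by simp
next
  case (Suc k)
  then have eq: "(f ^^ k) x n = circ n i ! (p + k)"
    using nth_c[of i n "p + k"] assms by simp
  have "(f ^^ Suc k) x n = (if Suc (p + k) = len n i then v n else circ n i ! Suc (p + k))"
    using circ_successor[of i n "p + k"] funpow_edge[OF assms(1), of k n] eq Suc.prems assms by simp
  then show ?case using nth_c[of i n "p + Suc k"] Suc.prems assms by simp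
qed

section \<open>Itineraries in a fixed level\<close>

fun down :: "nat \<Rightarrow> nat \<Rightarrow> 'v \<Rightarrow> 'v" where
  "down N 0 u = u"
| "down N (Suc k) u = down N k (\<phi> (N + k) u)"

lemma down_base [simp]: "down N k (v (N + k)) = v N"
  by (induction k) (auto simp: phi_base)

lemma down_X: "x \<in> X \<Longrightarrow> down N k (x (N + k)) = x N"
  by (induction k) (auto simp: X_phi)

lemma X_agree_below:
  assumes "x \<in> X" "y \<in> X" "x n = y n" "m \<le> n"
  shows "x m = y m"
proof -
  obtain k where "n = m + k" using assms(4) le_Suc_ex by blast
  then show ?thesis using down_X[OF assms(1), of m k] down_X[OF assms(2), of m k] assms(3) by simp
qed

definition itin :: "nat \<Rightarrow> nat \<Rightarrow> nat \<Rightarrow> 'v list" where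
  "itin N k i = map (down N k) (circ (N + k) i)"

lemma length_itin [simp]: "length (itin N k i) = len (N + k) i"
  by (simp add: itin_def)

lemma itin_0: "itin N 0 i = circ N i"
  by (simp add: itin_def map_idI)

lemma itin_Suc:
  assumes "1 \<le> i" "i \<le> N + k"
  shows "itin N (Suc k) i =
    [v N] @ concat (map (\<lambda>j. itin N k j @ itin N k j) [i..<Suc (N + k)]) @ [v N]"
proof -
  have "itin N (Suc k) i = map (down N k) (map (\<phi> (N + k)) (circ (Suc (N + k)) i))"
    by (simp add: itin_def)
  then show ?thesis
    unfolding map_phi_circ[OF assms] by (simp add: map_concat comp_def itin_def del: upt_Suc)
qed

text \<open>The circuit of index \<open>Suc n\<close> in level \<open>Suc n\<close> is collapsed to the base vertex,
  and the images of circuits involve only circuits of at least the same index.\<close>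

lemma itin_above:
  assumes "N < i" "i \<le> N + k"
  shows "itin N k i = replicate (len (N + k) i) (v N)"
proof -
  have "set (itin N k i) \<subseteq> {v N}"
    using assms
  proof (induction k arbitrary: i)
    case (Suc k)
    show ?case
    proof (cases "i \<le> N + k")
      case True
      have "set (itin N k j) \<subseteq> {v N}" if "j \<in> set [i..<Suc (N + k)]" for j
        using that Suc.prems by (intro Suc.IH) auto
      then show ?thesis
        using True Suc.prems by (auto simp: itin_Suc simp del: upt_Suc set_upt)
    next
      case False
      then have "i = Suc (N + k)" using Suc.prems by simp
      then show ?thesis
        using circ_last_image[of _ "N + k"] by (auto simp: itin_def in_set_conv_nth)
    qed
  qed simp
  then show ?thesis
    by (intro replicate_eqI) auto
qed

section \<open>Runs of base vertices in itineraries\<close>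

text \<open>The length of the run of base vertices at the end of \<open>itin N k i\<close>, for every
  \<open>i \<le> N\<close>. Passing to the next level appends to the tail of the last copy of
  \<open>circ (N + k) N\<close> the collapsed circuits of index above \<open>N\<close> and one loop.\<close>

fun tail_len :: "nat \<Rightarrow> nat \<Rightarrow> nat" where
  "tail_len N 0 = 0"
| "tail_len N (Suc k) = tail_len N k + 1 + 2 * (\<Sum>j=Suc N..N + k. len (N + k) j)"

lemma tail_len_Suc_ge: "tail_len N k + 1 + 4 * k \<le> tail_len N (Suc k)"
proof -
  have "(\<Sum>j=Suc N..N + k. 2) \<le> (\<Sum>j=Suc N..N + k. len (N + k) j)"
    by (intro sum_mono len_ge_2) auto
  then show ?thesis by simp
qed

lemma le_tail_len: "k \<le> tail_len N k"
proof (induction k)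
  case (Suc k)
  then show ?case using tail_len_Suc_ge[of N k] by linarith
qed simp

lemma concat_itin_above:
  "concat (map (\<lambda>j. itin N k j @ itin N k j) [Suc N..<Suc (N + k)]) =
    replicate (2 * (\<Sum>j=Suc N..N + k. len (N + k) j)) (v N)"
proof -
  let ?L = "concat (map (\<lambda>j. itin N k j @ itin N k j) [Suc N..<Suc (N + k)])"
  have "set ?L \<subseteq> {v N}"
    using itin_above[of N _ k] by (auto simp del: upt_Suc)
  moreover have "length ?L = (\<Sum>j=Suc N..N + k. len (N + k) j + len (N + k) j)"
    by (simp add: length_concat comp_def interv_sum_list_conv_sum_set_nat
        atLeastLessThanSuc_atLeastAtMost del: upt_Suc)
  ultimately have "?L = replicate (\<Sum>j=Suc N..N + k. len (N + k) j + len (N + k) j) (v N)"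
    by (intro replicate_eqI) auto
  then show ?thesis by (simp add: sum.distrib mult_2)
qed

text \<open>By induction along the substitution: the copies of circuits of index at most \<open>N\<close> are
  separated by their tails. Such a tail together with the initial run that follows it, of length at most
  \<open>k + 1\<close>, is no longer than the tail of the next level, by \<open>tail_len_Suc_ge\<close>.\<close>

lemma itin_gaps:
  assumes "1 \<le> i" "i \<le> N"
  shows "\<exists>Z. itin N k i = Z @ replicate (tail_len N k) (v N) \<and> gaps_le (v N) (Suc k) (tail_len N k) Z"
  using assms
proof (induction k arbitrary: i)
  case 0
  have nb: "circ N i ! q \<noteq> v N" if "1 \<le> q" "q < len N i" for q
    using circ_eq_base_iff[of i N q] that 0 by auto
  have "gaps_le (v N) (Suc 0) 0 (circ N i)"
    unfolding gaps_le_def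
  proof (intro conjI allI impI)
    show "\<exists>q\<le>Suc 0. q < length (circ N i) \<and> circ N i ! q \<noteq> v N"
      using nb[of 1] len_ge_2[of i N] 0 by (intro exI[of _ 1]) auto
  qed (use nb in auto)
  then show ?case by (simp add: itin_0)
next
  case (Suc k)
  let ?t = "tail_len N k" and ?t' = "tail_len N (Suc k)" and ?S = "2 * (\<Sum>j=Suc N..N + k. len (N + k) j)"
  let ?Bs = "concat (map (\<lambda>j. [itin N k j, itin N k j]) [i..<Suc N])"
  have t: "?t + Suc k \<le> ?t'" "?t \<le> ?t'"
    using tail_len_Suc_ge[of N k] by linarith+
  have "\<exists>Z. itin N k j = Z @ replicate ?t (v N) \<and> gaps_le (v N) (Suc k) ?t' Z"
    if "j \<in> set [i..<Suc N]" for j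
    using Suc.IH[of j] that Suc.prems gaps_le_mono[OF _ t(2)] by fastforce
  then have "\<forall>B\<in>set ?Bs. \<exists>Z. B = Z @ replicate ?t (v N) \<and> gaps_le (v N) (Suc k) ?t' Z"
    by (auto simp del: upt_Suc)
  moreover have "?Bs \<noteq> []"
    using Suc.prems by simp
  ultimately obtain Z where Z: "concat ?Bs = Z @ replicate ?t (v N)" "gaps_le (v N) (Suc k) ?t' Z"
    using gaps_le_concat[of ?Bs ?t "v N" "Suc k" ?t'] t by blast
  have split: "[i..<Suc (N + k)] = [i..<Suc N] @ [Suc N..<Suc (N + k)]"
    using Suc.prems upt_add_eq_append[of i "Suc N" k] by simp
  have "concat (map (\<lambda>j. itin N k j @ itin N k j) js) =
      concat (concat (map (\<lambda>j. [itin N k j, itin N k j]) js))" for js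
    by (induction js) auto
  then have "itin N (Suc k) i = [v N] @ (Z @ replicate ?t (v N)) @ replicate ?S (v N) @ [v N]"
    using itin_Suc[of i N k] Suc.prems concat_itin_above[of N k] Z(1)
    unfolding split by simp
  also have "\<dots> = (v N # Z) @ replicate (?t + 1 + ?S) (v N)"
    by (simp add: replicate_add replicate_append_same)
  finally show ?case
    using gaps_le_Cons[OF Z(2)] by (intro exI[of _ "v N # Z"]) simp
qed

lemma funpow_itin:
  assumes "x \<in> X" "1 \<le> i" "i \<le> N + k" "1 \<le> p" "p < len (N + k) i" "x (N + k) = circ (N + k) i ! p"
    and "p + s \<le> len (N + k) i"
  shows "(f ^^ s) x N = (if p + s = len (N + k) i then v N else itin N k i ! (p + s))"
proof -
  have "(f ^^ s) x (N + k) = c (N + k) i ! (p + s)"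
    using assms by (intro funpow_along_circ) (auto simp: nth_c)
  then have "(f ^^ s) x N = down N k (c (N + k) i ! (p + s))"
    using down_X[OF funpow_in_X[OF assms(1)], of N k s] by simp
  then show ?thesis
    using assms by (simp add: nth_c itin_def)
qed

lemma final_run:
  assumes "x \<in> X" "1 \<le> i" "i \<le> N" "1 \<le> p" "p < len (N + k) i" "x (N + k) = circ (N + k) i ! p"
    and "p + s \<le> len (N + k) i" "len (N + k) i \<le> p + s + tail_len N k"
  shows "(f ^^ s) x N = v N"
proof -
  obtain Z where Z: "itin N k i = Z @ replicate (tail_len N k) (v N)"
    using itin_gaps[OF assms(2,3)] by blast
  then have "len (N + k) i = length Z + tail_len N k"
    by (metis length_append length_itin length_replicate)
  then show ?thesis
    using funpow_itin[of x i N k p s] assms Z by (auto simp: nth_append)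
qed

text \<open>Together with \<open>final_run\<close> this says: for a point inside a circuit of level
  \<open>N + k\<close>, and before its final run, the first \<open>tail_len N k + 1\<close> consecutive visits
  to the base vertex of level \<open>N\<close> are those that finish at the end of that circuit.\<close>

lemma no_earlier_run:
  assumes "x \<in> X" "1 \<le> i" "i \<le> N" "1 \<le> p" "p < len (N + k) i" "x (N + k) = circ (N + k) i ! p"
    and "p + s + tail_len N k < len (N + k) i"
  obtains s' where "s \<le> s'" "s' \<le> s + tail_len N k" "p + s' + tail_len N k < len (N + k) i"
    "(f ^^ s') x N \<noteq> v N"
proof -
  obtain Z where Z: "itin N k i = Z @ replicate (tail_len N k) (v N)"
    "gaps_le (v N) (Suc k) (tail_len N k) Z"
    using itin_gaps[OF assms(2,3)] by blast
  then have l: "len (N + k) i = length Z + tail_len N k"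
    by (metis length_append length_itin length_replicate)
  have "1 \<le> p + s" "p + s < length Z"
    using assms l by auto
  then obtain q where q: "q \<ge> p + s" "q \<le> Suc k \<or> q \<le> p + s + tail_len N k" "q < length Z"
    "Z ! q \<noteq> v N"
    using Z(2) unfolding gaps_le_def by blast
  show ?thesis
  proof (rule that[of "q - p"])
    show "s \<le> q - p" "p + (q - p) + tail_len N k < len (N + k) i"
      using q l by auto
    show "q - p \<le> s + tail_len N k"
      using q(2) le_tail_len[of k N] assms(4) by linarith
    show "(f ^^ (q - p)) x N \<noteq> v N"
      using funpow_itin[of x i N k p "q - p"] assms q l Z(1) by (auto simp: nth_append)
  qed
qed

section \<open>Points away from the fixed point\<close>

text \<open>From level \<open>N\<close> on, the point \<open>x\<close> lies inside circuits of the fixed index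
  \<open>i\<close>, at position \<open>p n\<close> in level \<open>n\<close>. The difference
  \<open>len n i - p n\<close>, the time until the circuit is completed, is the clock by which two points are
  compared below.\<close>

definition follows :: "(nat \<Rightarrow> 'v) \<Rightarrow> nat \<Rightarrow> nat \<Rightarrow> (nat \<Rightarrow> nat) \<Rightarrow> bool" where
  "follows x i N p \<longleftrightarrow> x \<in> X \<and> 1 \<le> i \<and> i \<le> N \<and>
     (\<forall>n\<ge>N. 1 \<le> p n \<and> p n < len n i \<and> x n = circ n i ! p n)"

lemma base_X: "v \<in> X"
  unfolding X_iff by (metis base_in_V phi_base)

lemma nonbase_persists:
  assumes "x \<in> X" "x m \<noteq> v m" "m \<le> n" shows "x n \<noteq> v n"
  using X_agree_below[OF assms(1) base_X _ assms(3)] assms(2) by blast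

text \<open>The index of the circuit through \<open>x n\<close> cannot increase with \<open>n\<close>, so it becomes
  constant.\<close>

lemma follows_exists:
  assumes x: "x \<in> X" "x \<noteq> v"
  obtains i N p where "follows x i N p"
proof -
  obtain m where m: "x m \<noteq> v m" using x by auto
  have "\<exists>i p. 1 \<le> i \<and> i \<le> n \<and> 1 \<le> p \<and> p < len n i \<and> x n = circ n i ! p" if "m \<le> n" for n
    using vertex_cases[OF X_in_V[OF x(1)], of n] nonbase_persists[OF x(1) m that] by metis
  then obtain I p where Ip: "\<And>n. m \<le> n \<Longrightarrow>
      1 \<le> I n \<and> I n \<le> n \<and> 1 \<le> p n \<and> p n < len n (I n) \<and> x n = circ n (I n) ! p n"
    by metis
  have mono: "I (Suc n) \<le> I n" if "m \<le> n" for n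
  proof -
    have "x n \<noteq> v n" using nonbase_persists[OF x(1) m that] .
    then show ?thesis
      using phi_circ_index_mono[of "I (Suc n)" n "p (Suc n)" "I n" "p n"]
        Ip[OF that] Ip[of "Suc n"] that X_phi[OF x(1), of n] by simp
  qed
  define i where "i = (LEAST j. \<exists>n\<ge>m. I n = j)"
  obtain N where N: "N \<ge> m" "I N = i"
    unfolding i_def using LeastI_ex[of "\<lambda>j. \<exists>n\<ge>m. I n = j"] by blast
  \<comment> \<open>A decreasing sequence stays at its minimum.\<close>
  have const: "I n = i" if "N \<le> n" for n
    using that
  proof (induction n rule: dec_induct)
    case (step n)
    then have "I (Suc n) \<le> i" using mono[of n] N by simp
    moreover have "i \<le> I (Suc n)"
      unfolding i_def by (intro Least_le exI[of _ "Suc n"]) (use step N in simp)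
    ultimately show ?case by simp
  qed (use N in simp)
  have "follows x i N p"
    unfolding follows_def using x(1) Ip const N by (metis dual_order.trans)
  then show ?thesis by (rule that)
qed

lemma follows_later: "follows x i N p \<Longrightarrow> N \<le> M \<Longrightarrow> follows x i M p"
  by (auto simp: follows_def)

text \<open>The second alternative is the one where the position in level \<open>Suc n\<close> is in the first of the
  two copies of \<open>circ n i\<close>, so that one more copy is still to come.\<close>

lemma follows_step:
  assumes "follows x i N p" "N \<le> n"
  shows "len (Suc n) i - p (Suc n) = len n i - p n + 1 + 2 * (\<Sum>j=Suc i..n. len n j) \<or>
    len (Suc n) i - p (Suc n) = len n i - p n + 1 + 2 * (\<Sum>j=Suc i..n. len n j) + len n i"
proof -
  have i: "1 \<le> i" "i \<le> n" and p: "1 \<le> p n" "p n < len n i" "x n = circ n i ! p n"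
    and p': "1 \<le> p (Suc n)" "p (Suc n) < len (Suc n) i" "x (Suc n) = circ (Suc n) i ! p (Suc n)"
    using assms by (auto simp: follows_def)
  have "\<phi> n (circ (Suc n) i ! p (Suc n)) = circ n i ! p n"
    using X_phi[of x n] assms p p' by (simp add: follows_def)
  then have "p (Suc n) = 1 + p n \<or> p (Suc n) = 1 + len n i + p n"
    using phi_circ_preimage_cases i p p' by blast
  moreover have "len (Suc n) i = 2 + 2 * len n i + 2 * (\<Sum>j=Suc i..n. len n j)"
    using len_Suc[OF i] i by (simp add: sum.atLeast_Suc_atMost)
  ultimately show ?thesis using p by auto
qed

lemma follows_remaining_ge:
  assumes "follows x i N p" shows "n \<le> len (N + n) i - p (N + n)"
proof (induction n)
  case (Suc n)
  then show ?case using follows_step[OF assms, of "N + n"] by auto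
qed simp

lemma tail_len_le_len:
  assumes "1 \<le> N" shows "tail_len N k \<le> len (N + k) N"
proof -
  obtain Z where "itin N k N = Z @ replicate (tail_len N k) (v N)"
    using itin_gaps[of N N k] assms by blast
  then have "len (N + k) N = length Z + tail_len N k"
    by (metis length_append length_itin length_replicate)
  then show ?thesis by simp
qed

text \<open>The final run of level \<open>N + Suc k\<close> starts only after the circuit of level
  \<open>N + k\<close> is completed: in between lie the two copies of \<open>circ (N + k) N\<close>, and each of
  them is at least as long as its own tail. This is where \<open>i < N\<close> enters.\<close>

lemma follows_room:
  assumes "follows x i N p" "i < N"
  shows "len (N + k) i - p (N + k) + tail_len N (Suc k) \<le> len (N + Suc k) i - p (N + Suc k)"
proof -
  have "tail_len N (Suc k) \<le> 1 + 2 * (len (N + k) N + (\<Sum>j=Suc N..N + k. len (N + k) j))"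
    using tail_len_le_len[of N k] assms(2) by simp
  also have "len (N + k) N + (\<Sum>j=Suc N..N + k. len (N + k) j) = (\<Sum>j=N..N + k. len (N + k) j)"
    by (simp add: sum.atLeast_Suc_atMost)
  also have "\<dots> \<le> (\<Sum>j=Suc i..N + k. len (N + k) j)"
    using assms(2) by (intro sum_mono2) auto
  finally show ?thesis
    using follows_step[OF assms(1), of "N + k"] by auto
qed

section \<open>There are no asymptotic pairs\<close>

text \<open>If \<open>y\<close> completed its circuit later than \<open>x\<close>, then the final run of
  \<open>x\<close> in level \<open>N\<close> would, by the agreement, also be a run of \<open>y\<close>, which starts
  too early for its length.\<close>

lemma synchronized_le:
  assumes x: "follows x i N p" "i < N" and y: "follows y j N q" "j < N"
    and agree: "\<forall>s\<ge>K. (f ^^ s) x N = (f ^^ s) y N"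
    and K: "K \<le> len (N + k) i - p (N + k)"
  shows "len (N + Suc k) j - q (N + Suc k) \<le> len (N + Suc k) i - p (N + Suc k)"
proof (rule ccontr)
  let ?n = "N + Suc k" and ?t = "tail_len N (Suc k)"
  let ?r = "len ?n i - p ?n"
  assume late: "\<not> ?thesis"
  have px: "x \<in> X" "1 \<le> i" "i \<le> N" "1 \<le> p ?n" "p ?n < len ?n i" "x ?n = circ ?n i ! p ?n"
    and qy: "y \<in> X" "1 \<le> j" "j \<le> N" "1 \<le> q ?n" "q ?n < len ?n j" "y ?n = circ ?n j ! q ?n"
    using x y by (auto simp: follows_def)
  have K': "K + ?t \<le> ?r"
    using follows_room[OF x, of k] K by linarith
  have "q ?n + (?r - ?t) + ?t < len ?n j"
    using late K' by linarith
  then obtain s where s: "?r - ?t \<le> s" "s \<le> ?r - ?t + ?t" "(f ^^ s) y N \<noteq> v N"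
    using no_earlier_run[OF qy, of "?r - ?t"] by metis
  moreover have "(f ^^ s) x N = v N"
    using final_run[OF px, of s] s(1,2) K' px(5) by linarith
  moreover have "K \<le> s"
    using s(1) K' by linarith
  ultimately show False
    using agree by metis
qed

lemma synchronized:
  assumes "follows x i N p" "i < N" "follows y j N q" "j < N"
    and "\<forall>s\<ge>K. (f ^^ s) x N = (f ^^ s) y N"
    and "K \<le> len (N + k) i - p (N + k)" "K \<le> len (N + k) j - q (N + k)"
  shows "len (N + Suc k) i - p (N + Suc k) = len (N + Suc k) j - q (N + Suc k)"
  using synchronized_le[of x i N p y j q K k] synchronized_le[of y j N q x i p K k] assms
  by (metis le_antisym)

text \<open>The final runs are preceded by a vertex other than the base vertex. This settles the pairs that contain
  the fixed point.\<close>

lemma follows_visits_nonbase: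
  assumes x: "follows x i N p" "i < N"
  shows "\<exists>s\<ge>K. (f ^^ s) x N \<noteq> v N"
proof -
  let ?n = "N + Suc (Suc K)" and ?t = "tail_len N (Suc (Suc K))"
  let ?r = "len ?n i - p ?n"
  have "Suc K \<le> len (N + Suc K) i - p (N + Suc K)"
    by (rule follows_remaining_ge[OF x(1)])
  then have r: "Suc K + ?t \<le> ?r"
    using follows_room[OF x, of "Suc K"] by linarith
  have px: "x \<in> X" "1 \<le> i" "i \<le> N" "1 \<le> p ?n" "p ?n < len ?n i" "x ?n = circ ?n i ! p ?n"
    using x by (auto simp: follows_def)
  have "p ?n + K + ?t < len ?n i"
    using r px by linarith
  then show ?thesis
    using no_earlier_run[OF px] by metis
qed

lemma follows_agree_remaining:
  assumes x: "follows x i N p" "i < N" and y: "follows y j N q" "j < N"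
    and agree: "\<forall>s\<ge>K. (f ^^ s) x N = (f ^^ s) y N" and "K \<le> k"
  shows "len (N + Suc k) i - p (N + Suc k) = len (N + Suc k) j - q (N + Suc k)"
  using follows_remaining_ge[OF x(1), of k] follows_remaining_ge[OF y(1), of k] assms(6)
  by (intro synchronized[OF x y agree]) auto

text \<open>In one step the remaining time of \<open>x\<close> grows at least by twice the lengths of the circuits of
  index above \<open>i\<close>, including \<open>j\<close>, and that of \<open>y\<close> at most by
  \<open>len n j\<close> more than twice the lengths of those of index above \<open>j\<close>. The remaining times
  could therefore not agree twice in a row if \<open>i < j\<close>.\<close>

lemma follows_agree_index:
  assumes x: "follows x i N p" "i < N" and y: "follows y j N q" "j < N"
    and agree: "\<forall>s\<ge>K. (f ^^ s) x N = (f ^^ s) y N"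
  shows "j \<le> i"
proof (rule ccontr)
  assume "\<not> j \<le> i"
  then have ij: "Suc i \<le> j" by simp
  let ?n = "N + Suc K"
  have n: "N \<le> ?n" "1 \<le> j" "j \<le> ?n" using y by (auto simp: follows_def)
  have "{Suc i..?n} = {Suc i..j} \<union> {Suc j..?n}"
    using ij n by auto
  then have "(\<Sum>m=Suc i..?n. len ?n m) = (\<Sum>m=Suc i..j. len ?n m) + (\<Sum>m=Suc j..?n. len ?n m)"
    by (simp add: sum.union_disjoint)
  moreover have "len ?n j \<le> (\<Sum>m=Suc i..j. len ?n m)"
    using ij by (intro member_le_sum) auto
  moreover have "2 \<le> len ?n j" using len_ge_2 n by blast
  moreover have "len ?n i - p ?n = len ?n j - q ?n"
    using follows_agree_remaining[OF x y agree, of K] by simp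
  moreover have "len (Suc ?n) i - p (Suc ?n) = len (Suc ?n) j - q (Suc ?n)"
    using follows_agree_remaining[OF x y agree, of "Suc K"] by simp
  ultimately show False
    using follows_step[OF x(1) n(1)] follows_step[OF y(1) n(1)] by linarith
qed

lemma follows_agree_eq:
  assumes x: "follows x i N p" "i < N" and y: "follows y j N q" "j < N"
    and agree: "\<forall>s\<ge>K. (f ^^ s) x N = (f ^^ s) y N"
  shows "x = y"
proof
  fix m
  have "\<forall>s\<ge>K. (f ^^ s) y N = (f ^^ s) x N"
    using agree by simp
  then have "i = j"
    using follows_agree_index[OF x y agree] follows_agree_index[OF y x] by fastforce
  let ?n = "N + Suc (K + m)"
  have "len ?n i - p ?n = len ?n j - q ?n"
    using follows_agree_remaining[OF x y agree, of "K + m"] by simp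
  moreover have "p ?n < len ?n i" "q ?n < len ?n j"
    and pq: "x ?n = circ ?n i ! p ?n" "y ?n = circ ?n j ! q ?n" and X: "x \<in> X" "y \<in> X"
    using x(1) y(1) by (auto simp: follows_def)
  ultimately have "p ?n = q ?n" using \<open>i = j\<close> by (metis diff_diff_cancel less_imp_le)
  then have "x ?n = y ?n" using pq \<open>i = j\<close> by simp
  then show "x m = y m" using X by (rule_tac X_agree_below[of x y ?n m]) auto
qed

lemma f_base: "f v = v"
  unfolding inverse_limit_map_def
  using base_X base_loop f_unique_exists[OF base_X] by (intro the1_equality) auto

lemma funpow_base: "(f ^^ k) v = v"
  by (induction k) (simp_all add: f_base)

theorem not_asymptotic:
  assumes "x \<in> X" "y \<in> X" "x \<noteq> y"
  shows "\<exists>N. \<forall>K. \<exists>s\<ge>K. (f ^^ s) x N \<noteq> (f ^^ s) y N"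
proof -
  have away_from_base: "\<exists>N. \<forall>K. \<exists>s\<ge>K. (f ^^ s) z N \<noteq> (f ^^ s) v N" if "z \<in> X" "z \<noteq> v" for z
  proof -
    obtain i N p where "follows z i N p" using follows_exists \<open>z \<in> X\<close> \<open>z \<noteq> v\<close> by blast
    then have "follows z i (Suc N) p" "i < Suc N"
      using follows_later by (auto simp: follows_def)
    then show ?thesis
      using follows_visits_nonbase funpow_base by metis
  qed
  consider "x = v" | "y = v" | "x \<noteq> v" "y \<noteq> v" by blast
  then show ?thesis
  proof cases
    case 1
    then show ?thesis using away_from_base[of y] assms by metis
  next
    case 2
    then show ?thesis using away_from_base[of x] assms by metis
  next
    case 3
    obtain i M p where x: "follows x i M p" using follows_exists assms(1) 3 by blast
    obtain j L q where y: "follows y j L q" using follows_exists assms(2) 3 by blast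
    define N where "N = Suc (max M L)"
    have "follows x i N p" "i < N" "follows y j N q" "j < N"
      using follows_later[OF x, of N] follows_later[OF y, of N] x y
      by (auto simp: N_def follows_def)
    then show ?thesis
      using follows_agree_eq assms(3) by metis
  qed
qed

section \<open>Visits to the base vertex have density one\<close>

definition nonbase_count :: "nat \<Rightarrow> nat \<Rightarrow> nat \<Rightarrow> nat" where
  "nonbase_count N k i = length (filter (\<lambda>u. u \<noteq> v N) (itin N k i))"

lemma nonbase_count_above: "N < i \<Longrightarrow> i \<le> N + k \<Longrightarrow> nonbase_count N k i = 0"
  by (simp add: nonbase_count_def itin_above)

lemma nonbase_count_Suc:
  assumes "1 \<le> i" "i \<le> N + k"
  shows "nonbase_count N (Suc k) i = 2 * (\<Sum>j=i..N + k. nonbase_count N k j)"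
proof -
  have "nonbase_count N (Suc k) i = sum_list (map (\<lambda>j. nonbase_count N k j + nonbase_count N k j) [i..<Suc (N + k)])"
    unfolding nonbase_count_def itin_Suc[OF assms]
    by (simp add: filter_concat length_concat comp_def del: upt_Suc)
  also have "\<dots> = (\<Sum>j=i..N + k. nonbase_count N k j + nonbase_count N k j)"
    by (simp add: interv_sum_list_conv_sum_set_nat atLeastLessThanSuc_atLeastAtMost del: upt_Suc)
  finally show ?thesis by (simp add: sum.distrib)
qed

text \<open>This and \<open>len_recursion\<close> are the same linear recursion; only the boundary values
  differ.\<close>

lemma nonbase_count_recursion:
  assumes "1 \<le> i" "i < N + k"
  shows "nonbase_count N (Suc k) i = nonbase_count N (Suc k) (Suc i) + 2 * nonbase_count N k i"
  using assms by (simp add: nonbase_count_Suc sum.atLeast_Suc_atMost)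

lemma len_recursion:
  assumes "1 \<le> i" "i < n"
  shows "len (Suc n) i = len (Suc n) (Suc i) + 2 * len n i"
  using assms by (simp add: len_Suc sum.atLeast_Suc_atMost)

lemma len_Suc_ge: "1 \<le> i \<Longrightarrow> i \<le> n \<Longrightarrow> 2 * len n i + 2 \<le> len (Suc n) i"
  by (simp add: len_Suc sum.atLeast_Suc_atMost)

lemma len_ge_power: "1 \<le> i \<Longrightarrow> 2 ^ k \<le> len (i + k) i"
proof (induction k)
  case 0
  then show ?case using len_ge_2[of i i] by simp
next
  case (Suc k)
  then show ?case using len_Suc_ge[of i "i + k"] by simp
qed

text \<open>The factor \<open>k\<close> is what matters: the lengths grow faster than \<open>2 ^ k\<close>, the
  growth rate that the recursion has without its first summand.\<close>

lemma len_ge_mult_power: 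
  assumes "1 \<le> i" shows "k * 2 ^ k \<le> 2 * len (i + k) i"
proof (induction k)
  case (Suc k)
  show ?case
  proof (cases k)
    case 0
    then show ?thesis using len_ge_2[of i "Suc i"] assms by simp
  next
    case (Suc m)
    have "2 ^ k \<le> len (Suc i + k) (Suc i)"
      using len_ge_power[of "Suc i" k] by simp
    then show ?thesis
      using len_recursion[of i "i + k"] Suc.IH assms Suc by (simp add: algebra_simps)
  qed
qed simp

text \<open>The Stolz-Cesaro argument. Once the inequality with \<open>\<epsilon> / 2\<close> holds for the
  increments, which have index \<open>Suc i\<close>, it holds for the index \<open>i\<close> up to an error
  \<open>A * 2 ^ k\<close>, and this is absorbed by the remaining half because the lengths outgrow
  \<open>2 ^ k\<close>.\<close>

lemma nonbase_density_step:
  fixes \<epsilon> :: real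
  assumes i: "1 \<le> i" "i \<le> N" and "0 < \<epsilon>"
    and ev: "eventually (\<lambda>k. real (nonbase_count N k (Suc i)) \<le> \<epsilon> / 2 * len (N + k) (Suc i)) sequentially"
  shows "eventually (\<lambda>k. real (nonbase_count N k i) \<le> \<epsilon> * len (N + k) i) sequentially"
proof -
  obtain k0 where k0: "\<And>k. k0 \<le> k \<Longrightarrow> real (nonbase_count N k (Suc i)) \<le> \<epsilon> / 2 * len (N + k) (Suc i)"
    "1 \<le> k0"
    using ev unfolding eventually_sequentially by (metis le_trans nat_le_linear)
  define A where "A = nonbase_count N k0 i"
  have bound: "real (nonbase_count N k i) \<le> \<epsilon> / 2 * len (N + k) i + A * 2 ^ k" if "k0 \<le> k" for k
    using that
  proof (induction k rule: dec_induct)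
    case base
    have "real A \<le> A * 2 ^ k0" by (simp add: mult_le_cancel_left1)
    moreover have "0 \<le> \<epsilon> / 2 * len (N + k0) i" using \<open>0 < \<epsilon>\<close> by simp
    ultimately show ?case by (simp add: A_def)
  next
    case (step k)
    have ik: "i < N + k" using i step k0(2) by simp
    have "real (nonbase_count N (Suc k) i) = nonbase_count N (Suc k) (Suc i) + 2 * real (nonbase_count N k i)"
      using nonbase_count_recursion[OF i(1) ik] by simp
    also have "\<dots> \<le> \<epsilon> / 2 * len (N + Suc k) (Suc i) + 2 * (\<epsilon> / 2 * len (N + k) i + A * 2 ^ k)"
      using k0(1)[of "Suc k"] step by (intro add_mono) auto
    also have "\<dots> = \<epsilon> / 2 * (len (N + Suc k) (Suc i) + 2 * real (len (N + k) i)) + A * 2 ^ Suc k"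
      by (simp add: algebra_simps)
    also have "len (N + Suc k) (Suc i) + 2 * real (len (N + k) i) = len (N + Suc k) i"
      using len_recursion[OF i(1) ik] by simp
    finally show ?case .
  qed
  have "filterlim (\<lambda>k. real k) at_top sequentially"
    by (rule filterlim_real_sequentially)
  then have "eventually (\<lambda>k. 4 * A / \<epsilon> \<le> real k) sequentially"
    by (simp add: filterlim_at_top)
  moreover have "eventually (\<lambda>k. k0 \<le> k) sequentially"
    by (rule eventually_ge_at_top)
  ultimately show ?thesis
  proof eventually_elim
    case (elim k)
    obtain d where d: "N = i + d" using i(2) le_Suc_ex by blast
    have "real k * 2 ^ k \<le> real (d + k) * 2 ^ (d + k)"
      by (intro mult_mono power_increasing) auto
    also have "\<dots> = real ((d + k) * 2 ^ (d + k))" by simp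
    also have "\<dots> \<le> real (2 * len (i + (d + k)) i)"
      using len_ge_mult_power[OF i(1), of "d + k"] by (rule of_nat_mono)
    finally have "real k * 2 ^ k \<le> 2 * real (len (N + k) i)" by (simp add: d add.assoc)
    moreover have "4 * A / \<epsilon> * 2 ^ k \<le> real k * 2 ^ k"
      using elim(1) by (intro mult_right_mono) auto
    ultimately have "4 * A / \<epsilon> * 2 ^ k \<le> 2 * real (len (N + k) i)" by linarith
    then have "A * 2 ^ k \<le> \<epsilon> / 2 * len (N + k) i"
      using \<open>0 < \<epsilon>\<close> by (simp add: field_simps)
    then show ?case using bound[OF elim(2)] by linarith
  qed
qed

lemma nonbase_density:
  fixes \<epsilon> :: real
  assumes "1 \<le> i" "i \<le> Suc N" "0 < \<epsilon>"
  shows "eventually (\<lambda>k. real (nonbase_count N k i) \<le> \<epsilon> * len (N + k) i) sequentially"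
  using assms(2,1,3)
proof (induction i arbitrary: \<epsilon> rule: inc_induct)
  case base
  have "eventually (\<lambda>k. 1 \<le> k) sequentially" by (rule eventually_ge_at_top)
  then show ?case
    by eventually_elim (use base in \<open>simp add: nonbase_count_above\<close>)
next
  case (step i)
  then show ?case
    by (intro nonbase_density_step[of i N \<epsilon>] step.IH) auto
qed

lemma nonbase_density_uniform:
  fixes \<epsilon> :: real
  assumes "0 < \<epsilon>"
  obtains k where "\<And>i. 1 \<le> i \<Longrightarrow> i \<le> N + k \<Longrightarrow> real (nonbase_count N k i) \<le> \<epsilon> * len (N + k) i"
proof -
  have "eventually (\<lambda>k. \<forall>i\<in>{1..N}. real (nonbase_count N k i) \<le> \<epsilon> * len (N + k) i) sequentially"
    using assms by (intro eventually_ball_finite ballI nonbase_density) auto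
  from eventually_happens'[OF sequentially_bot this]
  obtain k where k: "\<forall>i\<in>{1..N}. real (nonbase_count N k i) \<le> \<epsilon> * len (N + k) i"
    by blast
  show ?thesis
  proof (rule that[of k])
    fix i assume i: "1 \<le> i" "i \<le> N + k"
    show "real (nonbase_count N k i) \<le> \<epsilon> * len (N + k) i"
    proof (cases "i \<le> N")
      case True
      then show ?thesis using k i by simp
    next
      case False
      then show ?thesis using nonbase_count_above[of N i k] i assms by simp
    qed
  qed
qed

text \<open>A potential turns the bound on each closed circuit into a bound on arbitrary walks, without cutting them
  into circuits: \<open>\<psi>\<close> records how often, since the last visit to the base vertex of level
  \<open>N + k\<close>, the walk was away from the base vertex in level \<open>N\<close>, minus
  \<open>\<epsilon>\<close> times the elapsed time. It jumps to \<open>0\<close> at the end of a circuit, which is a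
  jump upwards since the density of the whole circuit is at most \<open>\<epsilon>\<close>.\<close>

lemma potential_exists:
  fixes \<epsilon> :: real
  assumes "0 < \<epsilon>"
  obtains k and \<psi> :: "'v \<Rightarrow> real" where
    "\<And>u w. (u, w) \<in> E (N + k) \<Longrightarrow> of_bool (down N k u \<noteq> v N) \<le> \<epsilon> + \<psi> w - \<psi> u"
proof -
  obtain k where k: "\<And>i. 1 \<le> i \<Longrightarrow> i \<le> N + k \<Longrightarrow> real (nonbase_count N k i) \<le> \<epsilon> * len (N + k) i"
    using nonbase_density_uniform[OF assms] by blast
  let ?n = "N + k"
  define g where "g i p = real (length (filter (\<lambda>u. u \<noteq> v N) (take p (itin N k i)))) - \<epsilon> * p" for i p
  define P where "P u a \<longleftrightarrow> (\<exists>i p. 1 \<le> i \<and> i \<le> ?n \<and> p < len ?n i \<and> u = circ ?n i ! p \<and> a = g i p)" for u a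
  define \<psi> where "\<psi> u = (if u = v ?n then 0 else (SOME a. P u a))" for u
  have g0: "g i 0 = 0" for i by (simp add: g_def)
  have psi: "\<psi> (circ ?n i ! p) = g i p" if "1 \<le> i" "i \<le> ?n" "p < len ?n i" for i p
  proof (cases "circ ?n i ! p = v ?n")
    case True
    then show ?thesis using that circ_eq_base_iff[of i ?n p] g0 by (simp add: \<psi>_def)
  next
    case False
    have "P (circ ?n i ! p) (g i p)" unfolding P_def using that by blast
    then have "P (circ ?n i ! p) (SOME a. P (circ ?n i ! p) a)" by (rule someI)
    then obtain j q where j: "1 \<le> j" "j \<le> ?n" "q < len ?n j" "circ ?n i ! p = circ ?n j ! q"
      "(SOME a. P (circ ?n i ! p) a) = g j q"
      unfolding P_def by blast
    then have "i = j \<and> p = q"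
      using circ_inj[of i ?n j p q] that False by blast
    then have "(SOME a. P (circ ?n i ! p) a) = g i p"
      using j by simp
    then show ?thesis using False by (simp add: \<psi>_def)
  qed
  have g_Suc: "g i (Suc p) = g i p + of_bool (down N k (circ ?n i ! p) \<noteq> v N) - \<epsilon>"
    if "p < len ?n i" for i p
  proof -
    have "take (Suc p) (itin N k i) = take p (itin N k i) @ [down N k (circ ?n i ! p)]"
      using that by (simp add: take_Suc_conv_app_nth itin_def)
    then show ?thesis by (simp add: g_def algebra_simps)
  qed
  show ?thesis
  proof (rule that[of k \<psi>])
    fix u w assume "(u, w) \<in> E ?n"
    then show "of_bool (down N k u \<noteq> v N) \<le> \<epsilon> + \<psi> w - \<psi> u"
    proof (cases rule: edge_cases)
      case 1
      then show ?thesis using assms by simp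
    next
      case (2 i p)
      have "g i (len ?n i) \<le> 0"
        using k[OF 2(1,2)] by (simp add: g_def nonbase_count_def)
      \<comment> \<open>Equality holds unless \<open>w\<close> is the end of the circuit, where the potential is reset to \<open>0\<close>.\<close>
      then have "g i (Suc p) \<le> \<psi> w"
        using 2 psi[of i "Suc p"] by (auto simp: \<psi>_def)
      then show ?thesis
        using g_Suc[OF 2(3)] psi[OF 2(1-3)] 2(4) by simp
    qed
  qed
qed

text \<open>If at least one of the two orbits were away from the base vertex at all late times, the sum of their
  potentials would grow by \<open>1/2\<close> in each step (with \<open>\<epsilon> = 1/4\<close>), but it takes
  finitely many values only.\<close>

theorem common_base_visits:
  assumes "x \<in> X" "y \<in> X"
  shows "\<exists>s\<ge>K. (f ^^ s) x N = v N \<and> (f ^^ s) y N = v N"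
proof (rule ccontr)
  assume no: "\<not> ?thesis"
  obtain k and \<psi> :: "'v \<Rightarrow> real" where psi:
    "\<And>u w. (u, w) \<in> E (N + k) \<Longrightarrow> of_bool (down N k u \<noteq> v N) \<le> 1/4 + \<psi> w - \<psi> u"
    using potential_exists[of "1/4" N] by auto
  define h where "h s = \<psi> ((f ^^ s) x (N + k)) + \<psi> ((f ^^ s) y (N + k))" for s
  have visit: "of_bool ((f ^^ s) z N \<noteq> v N) \<le> 1/4 + \<psi> ((f ^^ Suc s) z (N + k)) - \<psi> ((f ^^ s) z (N + k))"
    if "z \<in> X" for z s
    using psi[OF funpow_edge[OF that, of s "N + k"]] down_X[OF funpow_in_X[OF that], of N k s] by simp
  have step: "h s + 1/2 \<le> h (Suc s)" if "K \<le> s" for s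
  proof -
    have "(f ^^ s) x N \<noteq> v N \<or> (f ^^ s) y N \<noteq> v N" using no that by blast
    then have "(1::real) \<le> of_bool ((f ^^ s) x N \<noteq> v N) + of_bool ((f ^^ s) y N \<noteq> v N)"
      by auto
    then show ?thesis
      using visit[OF assms(1), of s] visit[OF assms(2), of s] unfolding h_def by linarith
  qed
  have growth: "h K + m / 2 \<le> h (K + m)" for m
  proof (induction m)
    case (Suc m)
    then show ?case using step[of "K + m"] by (simp add: field_simps)
  qed simp
  obtain B where B: "\<And>u. u \<in> V (N + k) \<Longrightarrow> \<psi> u \<le> B"
    using bdd_above_finite[of "\<psi> ` V (N + k)"] finite_V unfolding bdd_above_def by auto
  have bounded: "h s \<le> 2 * B" for s
    using B[OF X_in_V[OF funpow_in_X[OF assms(1)]], of s] B[OF X_in_V[OF funpow_in_X[OF assms(2)]], of s]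
    unfolding h_def by linarith
  obtain m :: nat where "2 * (2 * B - h K) < m"
    using reals_Archimedean2 by blast
  moreover have "h K + m / 2 \<le> 2 * B"
    by (rule order_trans[OF growth bounded])
  ultimately show False
    by (simp add: algebra_simps)
qed

section \<open>A recurrent point with dense orbit\<close>

text \<open>Inside \<open>circ (Suc n) 1\<close> the first copy of \<open>circ n 1\<close> starts at position
  \<open>1\<close>, after the loop. So the positions increase by one from level to level if the first copy is chosen
  every time.\<close>

definition recurrent_point :: "nat \<Rightarrow> 'v" where
  "recurrent_point n = (if n = 0 then v 0 else circ n 1 ! n)"

lemma len_1_ge: "1 \<le> n \<Longrightarrow> 2 * n \<le> len n 1"
proof (induction n rule: dec_induct)
  case base
  then show ?case using len_ge_2[of 1 1] by simp
next
  case (step n)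
  then show ?case using len_Suc_ge[of 1 n] by simp
qed

lemma V_0: "V 0 = {v 0}"
  using vertices[of 0] by simp

lemma recurrent_point_X: "recurrent_point \<in> X"
proof -
  have V: "recurrent_point n \<in> V n" for n
    using len_1_ge[of n] circ_in_V[of 1 n n] base_in_V by (auto simp: recurrent_point_def)
  have "recurrent_point n = \<phi> n (recurrent_point (Suc n))" for n
  proof (cases "n = 0")
    case True
    then show ?thesis
      using phi_V[OF V, of 0] V_0 by (simp add: recurrent_point_def)
  next
    case False
    then show ?thesis
      using phi_circ_copies(1)[of 1 n n] len_1_ge[of n] by (simp add: recurrent_point_def)
  qed
  then show ?thesis
    using V unfolding X_iff by blast
qed

lemma recurrent_point_orbit:
  assumes "1 \<le> n" "n + s \<le> len n 1"
  shows "(f ^^ s) recurrent_point n = c n 1 ! (n + s)"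
  using assms len_1_ge[of n]
  by (intro funpow_along_circ recurrent_point_X) (auto simp: nth_c recurrent_point_def)

lemma recurrent_point_second_round:
  assumes "1 \<le> n" "q < len n 1"
  shows "(f ^^ (len n 1 + q - n)) recurrent_point n = circ n 1 ! q"
proof -
  let ?s = "len n 1 + q - n"
  have e: "Suc n + ?s = 1 + len n 1 + q" and l: "Suc n + ?s < len (Suc n) 1"
    using len_1_ge[of n] len_Suc_ge[of 1 n] assms by auto
  have "(f ^^ ?s) recurrent_point (Suc n) = c (Suc n) 1 ! (Suc n + ?s)"
    using l by (intro recurrent_point_orbit) auto
  also have "\<dots> = circ (Suc n) 1 ! (1 + len n 1 + q)"
    using nth_c[of 1 "Suc n" "Suc n + ?s"] l e by simp
  finally have "(f ^^ ?s) recurrent_point n = \<phi> n (circ (Suc n) 1 ! (1 + len n 1 + q))"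
    using X_phi[OF funpow_in_X[OF recurrent_point_X]] by metis
  then show ?thesis
    using phi_circ_copies(2)[of 1 n q] assms by simp
qed

text \<open>The image of \<open>circ (Suc N) 1\<close> contains all circuits of level \<open>N\<close>.\<close>

lemma itin_1_covers: "V N \<subseteq> set (itin N (Suc k) 1)"
proof (induction k)
  case 0
  show ?case
  proof (cases "N = 0")
    case True
    have "0 < len (Suc 0) (Suc 0)" using len_ge_2[of 1 1] by simp
    then show ?thesis using itin_above[of 0 1 1] V_0 True by simp
  next
    case False
    show ?thesis
    proof
      fix u assume "u \<in> V N"
      then show "u \<in> set (itin N (Suc 0) 1)"
      proof (cases rule: vertex_cases)
        case 1
        then show ?thesis using itin_Suc[of 1 N 0] False by simp
      next
        case (2 i p)
        then have "u \<in> set (itin N 0 i)" "i \<in> set [1..<Suc (N + 0)]"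
          by (auto simp: itin_0)
        then show ?thesis
          using False unfolding itin_Suc[of 1 N 0, simplified] by (auto simp del: upt_Suc set_upt simp: itin_Suc)
      qed
    qed
  qed
next
  case (Suc k)
  have "1 \<in> set [1..<Suc (N + Suc k)]" by (simp del: upt_Suc)
  then have "set (itin N (Suc k) 1) \<subseteq> set (itin N (Suc (Suc k)) 1)"
    using itin_Suc[of 1 N "Suc k"] by (auto simp del: upt_Suc set_upt)
  then show ?case using Suc by blast
qed

lemma recurrent_point_dense:
  assumes "u \<in> V N"
  shows "\<exists>s\<ge>K. (f ^^ s) recurrent_point N = u"
proof -
  let ?n = "N + Suc K"
  obtain q where q: "q < len ?n 1" "itin N (Suc K) 1 ! q = u"
    using itin_1_covers[of N K] assms by (metis in_set_conv_nth length_itin subsetD)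
  let ?s = "len ?n 1 + q - ?n"
  have "(f ^^ ?s) recurrent_point N = down N (Suc K) (circ ?n 1 ! q)"
    using down_X[OF funpow_in_X[OF recurrent_point_X], of N "Suc K" ?s]
      recurrent_point_second_round[of ?n q] q(1) by simp
  also have "\<dots> = u" using q by (simp add: itin_def)
  finally show ?thesis
    using len_1_ge[of ?n] by (intro exI[of _ ?s]) auto
qed

lemma recurrent_point_return:
  assumes "1 \<le> n"
  shows "(f ^^ len n 1) recurrent_point n = recurrent_point n"
  using recurrent_point_second_round[of n n] len_1_ge[of n] assms by (simp add: recurrent_point_def)

lemma len_1_gap:
  assumes "1 \<le> n" "Suc n \<le> m"
  shows "m + len n 1 < len m 1"
  using assms(2)
proof (induction m rule: dec_induct)
  case base
  then show ?case using len_1_ge[of n] len_Suc_ge[of 1 n] assms(1) by simp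
next
  case (step m)
  then show ?case using len_Suc_ge[of 1 m] by simp
qed

text \<open>Both points lie in circuits of index \<open>1\<close>: up to level \<open>n\<close> they coincide, and
  above it the positions differ by \<open>len n 1\<close>. Since \<open>1 < 2\<close>, agreement of the whole
  orbits in level \<open>2\<close> would force them to be equal.\<close>

lemma recurrent_point_unstable:
  assumes n: "2 \<le> n"
  shows "\<exists>s. (f ^^ s) recurrent_point 2 \<noteq> (f ^^ s) ((f ^^ len n 1) recurrent_point) 2"
proof (rule ccontr)
  let ?x = recurrent_point and ?y = "(f ^^ len n 1) recurrent_point"
  let ?q = "\<lambda>m. if m \<le> n then m else m + len n 1"
  assume "\<not> ?thesis"
  then have agree: "\<forall>s\<ge>0. (f ^^ s) ?x 2 = (f ^^ s) ?y 2" by blast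
  have X: "?x \<in> X" "?y \<in> X" using recurrent_point_X funpow_in_X by auto
  have x: "follows ?x 1 2 (\<lambda>m. m)"
    unfolding follows_def
  proof (intro conjI allI impI X)
    fix m :: nat assume m: "2 \<le> m"
    show "1 \<le> m" using m by simp
    show "m < len m 1" using len_1_ge[of m] m by simp
    show "?x m = circ m 1 ! m" using m by (simp add: recurrent_point_def)
  qed auto
  have late: "m + len n 1 < len m 1 \<and> ?y m = circ m 1 ! (m + len n 1)" if "n < m" for m
  proof -
    have l: "m + len n 1 < len m 1" using len_1_gap[of n m] n that by simp
    then show ?thesis
      using recurrent_point_orbit[of m "len n 1"] nth_c[of 1 m "m + len n 1"] that by simp
  qed
  have early: "?y m = ?x m" if "m \<le> n" for m
    using X_agree_below[OF X(2,1) _ that] recurrent_point_return[of n] n by simp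
  have y: "follows ?y 1 2 ?q"
    unfolding follows_def
  proof (intro conjI allI impI X)
    fix m :: nat assume m: "2 \<le> m"
    show "1 \<le> ?q m" using m by simp
    show "?q m < len m 1" using late[of m] len_1_ge[of m] m by auto
    show "?y m = circ m 1 ! ?q m"
      using late[of m] early[of m] m by (auto simp: recurrent_point_def)
  qed auto
  have "?x = ?y"
    using follows_agree_eq[OF x _ y _ agree] by simp
  then have "circ (Suc n) 1 ! Suc n = circ (Suc n) 1 ! (Suc n + len n 1)"
    using late[of "Suc n"] by (simp add: recurrent_point_def)
  then have "len n 1 = 0"
    using late[of "Suc n"] distinct_circ[of 1 "Suc n"] by (simp add: nth_eq_iff_index_eq)
  then show False using len_ge_2[of 1 n] n by simp
qed

section \<open>Cylinders, compactness and compatible metrics\<close>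

abbreviation T :: "(nat \<Rightarrow> 'v) topology" where
  "T \<equiv> inverse_limit_topology V \<phi>"

lemma X_subset: "X \<subseteq> topspace (product_topology (\<lambda>n. discrete_topology (V n)) UNIV)"
  by (auto simp: inverse_limit_def)

lemma topspace_T [simp]: "topspace T = X"
  using X_subset by (auto simp: inverse_limit_topology_def)

lemma openin_cylinder:
  assumes "u \<in> V n" shows "openin T {x \<in> X. x n = u}"
proof -
  have "openin (product_topology (\<lambda>n. discrete_topology (V n)) UNIV)
      {x \<in> topspace (product_topology (\<lambda>n. discrete_topology (V n)) UNIV). x n \<in> {u}}"
    by (rule openin_continuous_map_preimage[OF continuous_map_product_projection])
      (use assms in auto)
  then show ?thesis
    unfolding inverse_limit_topology_def openin_subtopology using X_subset by blast
qed

text \<open>A single coordinate suffices because each coordinate determines all lower ones.\<close>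

lemma open_contains_cylinder:
  assumes "openin T U" "x \<in> U"
  obtains n where "\<And>y. y \<in> X \<Longrightarrow> y n = x n \<Longrightarrow> y \<in> U"
proof -
  let ?P = "product_topology (\<lambda>n. discrete_topology (V n)) UNIV"
  obtain S where S: "openin ?P S" "U = S \<inter> X"
    using assms(1) by (auto simp: inverse_limit_topology_def openin_subtopology)
  then obtain W where W: "finite {i. W i \<noteq> V i}" "x \<in> Pi\<^sub>E UNIV W" "Pi\<^sub>E UNIV W \<subseteq> S"
    using assms(2) unfolding openin_product_topology_alt by auto
  then obtain n where n: "\<And>i. W i \<noteq> V i \<Longrightarrow> i \<le> n"
    using finite_nat_set_iff_bounded_le by auto
  have xX: "x \<in> X" using assms openin_subset by fastforce
  show ?thesis
  proof (rule that[of n])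
    fix y assume y: "y \<in> X" "y n = x n"
    have "y i \<in> W i" for i
    proof (cases "W i = V i")
      case True
      then show ?thesis using X_in_V[OF y(1)] by simp
    next
      case False
      then have "y i = x i" using X_agree_below[OF y(1) xX y(2) n] by simp
      then show ?thesis using W(2) by auto
    qed
    then show "y \<in> U" using W(3) S(2) y(1) by auto
  qed
qed

lemma compact_space_T: "compact_space T"
proof -
  let ?P = "product_topology (\<lambda>n. discrete_topology (V n)) UNIV"
  have "closedin ?P {x \<in> topspace ?P. x n = \<phi> n (x (Suc n))}" for n
  proof (rule closedin_continuous_maps_eq)
    show "Hausdorff_space (discrete_topology (V n))" by simp
    show "continuous_map ?P (discrete_topology (V n)) (\<lambda>x. x n)"
      by (intro continuous_map_product_projection) simp
    have "continuous_map ?P (discrete_topology (V (Suc n))) (\<lambda>x. x (Suc n))"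
      by (intro continuous_map_product_projection) simp
    moreover have "continuous_map (discrete_topology (V (Suc n))) (discrete_topology (V n)) (\<phi> n)"
      using phi_V by auto
    ultimately show "continuous_map ?P (discrete_topology (V n)) (\<lambda>x. \<phi> n (x (Suc n)))"
      using continuous_map_compose[unfolded comp_def] by fast
  qed
  then have "closedin ?P (\<Inter>n. {x \<in> topspace ?P. x n = \<phi> n (x (Suc n))})"
    by (intro closedin_Inter) auto
  moreover have "X = (\<Inter>n. {x \<in> topspace ?P. x n = \<phi> n (x (Suc n))})"
    unfolding inverse_limit_def topspace_product_topology topspace_discrete_topology by blast
  moreover have "compact_space ?P"
    using finite_V by (simp add: compact_space_product_topology compact_space_discrete_topology)
  ultimately show ?thesis
    unfolding inverse_limit_topology_def
    using closedin_compact_space compact_space_subtopology by metis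
qed

text \<open>The Lebesgue number of the partition into cylinders of level \<open>N\<close>.\<close>

lemma metric_small_imp_same_vertex:
  assumes "compatible_metric T d"
  obtains \<epsilon> where "0 < \<epsilon>" "\<And>x y. x \<in> X \<Longrightarrow> y \<in> X \<Longrightarrow> d x y < \<epsilon> \<Longrightarrow> x N = y N"
proof -
  interpret Metric_space X d
    using assms by (simp add: compatible_metric_def)
  have mT: "mtopology = T"
    using assms by (simp add: compatible_metric_def)
  let ?C = "(\<lambda>u. {x \<in> X. x N = u}) ` V N"
  have "\<exists>\<epsilon>>0. \<forall>x\<in>X. \<exists>U\<in>?C. mball x \<epsilon> \<subseteq> U"
  proof (rule lebesgue_number)
    show "compactin mtopology X"
      using compact_space_T by (simp add: compact_space_def mT)
    show "X \<subseteq> \<Union> ?C" using X_in_V by auto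
  qed (auto simp: mT openin_cylinder)
  then obtain \<epsilon> where e: "0 < \<epsilon>" "\<forall>x\<in>X. \<exists>U\<in>?C. mball x \<epsilon> \<subseteq> U" by blast
  show ?thesis
  proof (rule that[OF e(1)])
    fix x y assume xy: "x \<in> X" "y \<in> X" "d x y < \<epsilon>"
    then have "x \<in> mball x \<epsilon>" "y \<in> mball x \<epsilon>" using e(1) by auto
    then show "x N = y N" using e(2) xy(1) by blast
  qed
qed

lemma same_vertex_imp_metric_small:
  assumes "compatible_metric T d" "x \<in> X" "0 < \<epsilon>"
  obtains n where "\<And>y. y \<in> X \<Longrightarrow> y n = x n \<Longrightarrow> d x y < \<epsilon>"
proof -
  interpret Metric_space X d
    using assms(1) by (simp add: compatible_metric_def)
  have "openin T (mball x \<epsilon>)" "x \<in> mball x \<epsilon>"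
    using assms openin_mball by (auto simp: compatible_metric_def)
  then obtain n where "\<And>y. y \<in> X \<Longrightarrow> y n = x n \<Longrightarrow> y \<in> mball x \<epsilon>"
    using open_contains_cylinder by blast
  then show ?thesis by (intro that[of n]) auto
qed

section \<open>The three dynamical properties\<close>

text \<open>At a common visit to the base vertex of a high level both points are close to the fixed point, hence close
  to each other. Conversely, points at different vertices of one fixed level are uniformly apart by
  compactness.\<close>

theorem completely_scrambled_f:
  assumes d: "compatible_metric T d"
  shows "completely_scrambled T d f"
  unfolding completely_scrambled_def scrambled_set_def topspace_T
proof (intro ballI impI conjI)
  interpret Metric_space X d
    using d by (simp add: compatible_metric_def)
  fix x y assume xy: "x \<in> X" "y \<in> X" "x \<noteq> y"
  obtain N where N: "\<And>K. \<exists>s\<ge>K. (f ^^ s) x N \<noteq> (f ^^ s) y N"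
    using not_asymptotic[OF xy] by blast
  obtain \<epsilon> where e: "0 < \<epsilon>" "\<And>x y. x \<in> X \<Longrightarrow> y \<in> X \<Longrightarrow> d x y < \<epsilon> \<Longrightarrow> x N = y N"
    using metric_small_imp_same_vertex[OF d] by blast
  show "0 < limsup (\<lambda>n. ereal (d ((f ^^ n) x) ((f ^^ n) y)))"
    using N e(2) funpow_in_X xy by (intro limsup_pos[OF e(1)]) (metis not_le)
  show "liminf (\<lambda>n. ereal (d ((f ^^ n) x) ((f ^^ n) y))) = 0"
  proof (rule liminf_zero)
    fix \<epsilon> :: real and K :: nat assume "0 < \<epsilon>"
    then obtain n where n: "\<And>z. z \<in> X \<Longrightarrow> z n = v n \<Longrightarrow> d v z < \<epsilon> / 2"
      using same_vertex_imp_metric_small[OF d base_X, of "\<epsilon> / 2"] by auto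
    obtain s where s: "K \<le> s" "(f ^^ s) x n = v n" "(f ^^ s) y n = v n"
      using common_base_visits[OF xy(1,2)] by blast
    have X: "(f ^^ s) x \<in> X" "(f ^^ s) y \<in> X" using funpow_in_X xy by auto
    have "d ((f ^^ s) x) ((f ^^ s) y) \<le> d ((f ^^ s) x) v + d v ((f ^^ s) y)"
      using triangle X base_X by blast
    also have "\<dots> < \<epsilon> / 2 + \<epsilon> / 2"
      using n[OF X(1) s(2)] n[OF X(2) s(3)] commute by (intro add_strict_mono) auto
    finally show "\<exists>s\<ge>K. d ((f ^^ s) x) ((f ^^ s) y) < \<epsilon>" using s(1) by auto
  qed (rule nonneg)
qed

theorem topologically_transitive_f: "topologically_transitive T f"
  unfolding topologically_transitive_def
proof (intro allI impI)
  fix U W assume UW: "openin T U \<and> U \<noteq> {} \<and> openin T W \<and> W \<noteq> {}"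
  then obtain x y where xy: "x \<in> U" "y \<in> W" by blast
  have X: "x \<in> X" "y \<in> X" using UW xy openin_subset by fastforce+
  obtain m where m: "\<And>z. z \<in> X \<Longrightarrow> z m = x m \<Longrightarrow> z \<in> U"
    using open_contains_cylinder UW xy by blast
  obtain n where n: "\<And>z. z \<in> X \<Longrightarrow> z n = y n \<Longrightarrow> z \<in> W"
    using open_contains_cylinder UW xy by blast
  obtain s where s: "(f ^^ s) recurrent_point m = x m"
    using recurrent_point_dense[OF X_in_V[OF X(1)]] by blast
  obtain r where r: "Suc s \<le> r" "(f ^^ r) recurrent_point n = y n"
    using recurrent_point_dense[OF X_in_V[OF X(2)]] by blast
  have "(f ^^ s) recurrent_point \<in> U" "(f ^^ r) recurrent_point \<in> W"
    using m n s r funpow_in_X recurrent_point_X by auto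
  moreover have "(f ^^ r) recurrent_point = (f ^^ (r - s)) ((f ^^ s) recurrent_point)"
    using r(1) by (metis Suc_leD comp_apply funpow_add le_add_diff_inverse2)
  ultimately have "(f ^^ (r - s)) ` U \<inter> W \<noteq> {}" by auto
  then show "\<exists>n>0. (f ^^ n) ` U \<inter> W \<noteq> {}"
    using r(1) by (intro exI[of _ "r - s"]) auto
qed

text \<open>The recurrent point is not an equicontinuity point of its own orbit closure; the points of the orbit that
  violate the condition are its returns.\<close>

theorem not_locally_equicontinuous_f:
  assumes d: "compatible_metric T d"
  shows "\<not> locally_equicontinuous T d f"
proof
  let ?x = recurrent_point
  assume "locally_equicontinuous T d f"
  then have eq: "equicontinuity_point d f (orbit_closure T f ?x) ?x"
    using recurrent_point_X by (simp add: locally_equicontinuous_def)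
  obtain \<epsilon> where e: "0 < \<epsilon>" "\<And>x y. x \<in> X \<Longrightarrow> y \<in> X \<Longrightarrow> d x y < \<epsilon> \<Longrightarrow> x 2 = y 2"
    using metric_small_imp_same_vertex[OF d] by blast
  obtain \<delta> where del: "0 < \<delta>"
    "\<And>y k. y \<in> orbit_closure T f ?x \<Longrightarrow> d ?x y < \<delta> \<Longrightarrow> d ((f ^^ k) ?x) ((f ^^ k) y) < \<epsilon>"
    using eq e(1) unfolding equicontinuity_point_def by metis
  obtain m where m: "\<And>y. y \<in> X \<Longrightarrow> y m = ?x m \<Longrightarrow> d ?x y < \<delta>"
    using same_vertex_imp_metric_small[OF d recurrent_point_X del(1)] by blast
  define n where "n = m + 2"
  let ?y = "(f ^^ len n 1) ?x"
  have yX: "?y \<in> X" by (rule funpow_in_X[OF recurrent_point_X])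
  have "?y m = ?x m"
    using X_agree_below[OF yX recurrent_point_X recurrent_point_return] by (simp add: n_def)
  then have near: "d ?x ?y < \<delta>" using m yX by blast
  have "?y \<in> orbit_closure T f ?x"
  proof -
    have "?y \<in> full_orbit T f ?x" by (auto simp: full_orbit_def)
    then show ?thesis
      unfolding orbit_closure_def using yX closure_of_subset_Int[of T] by fastforce
  qed
  then have "(f ^^ k) ?x 2 = (f ^^ k) ?y 2" for k
    using del(2)[OF _ near] e(2) funpow_in_X recurrent_point_X yX by blast
  then show False
    using recurrent_point_unstable[of n] by (simp add: n_def)
qed

end

theorem theorem3p1:
  fixes V :: "nat \<Rightarrow> 'v set"
    and E :: "nat \<Rightarrow> ('v \<times> 'v) set"
    and v :: "nat \<Rightarrow> 'v"
    and c :: "nat \<Rightarrow> nat \<Rightarrow> 'v list"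
    and \<phi> :: "nat \<Rightarrow> 'v \<Rightarrow> 'v"
    and d :: "(nat \<Rightarrow> 'v) \<Rightarrow> (nat \<Rightarrow> 'v) \<Rightarrow> real"
  assumes "figure8_covers V E v c \<phi>"
    and "compatible_metric (inverse_limit_topology V \<phi>) d"
  shows "completely_scrambled (inverse_limit_topology V \<phi>) d (inverse_limit_map V E \<phi>) \<and>
         topologically_transitive (inverse_limit_topology V \<phi>) (inverse_limit_map V E \<phi>) \<and>
         \<not> locally_equicontinuous (inverse_limit_topology V \<phi>) d (inverse_limit_map V E \<phi>)"
  using figure8_covers.completely_scrambled_f[OF assms]
    figure8_covers.topologically_transitive_f[OF assms(1)]
    figure8_covers.not_locally_equicontinuous_f[OF assms]
  by blast

end
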